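(* Let $p$ be a prime and let $G$ be a finite, nonabelian, \emph{ea}-morphic $p$-group. Then $G$ is 2-generated, that is, $G$ can be generated by two elements.
   Context: A finite $p$-group $G$ is called elementary abelian morphic, or \emph{ea}-morphic for short, if for every normal subgroup $N$ of $G$ such that either $N$ is elementary abelian or $G/N$ is elementary abelian, the following holds: there is an epimorphism $G \to N$, and for every epimorphism $\varphi : G \to N$ one has $G/N \cong \ker(\varphi)$. (The trivial group counts as elementary abelian.) *)

theory Defs
  imports "HOL-Algebra.Algebra"
begin

text \<open>For prime \<open>p\<close>, the order condition forces the carrier to be finite, since \<open>order\<close>
  of an infinite group is \<open>0\<close>.\<close>

definition finite_p_group :: "nat \<Rightarrow> ('a, 'b) monoid_scheme \<Rightarrow> bool" where
  "finite_p_group p G \<longleftrightarrow> group G \<and> (\<exists>n::nat. order G = p ^ n)"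

text \<open>The trivial group is elementary abelian for every \<open>p\<close>.\<close>

definition elementary_abelian :: "nat \<Rightarrow> ('a, 'b) monoid_scheme \<Rightarrow> bool" where
  "elementary_abelian p G \<longleftrightarrow>
     comm_group G \<and> (\<forall>x \<in> carrier G. x [^]\<^bsub>G\<^esub> p = \<one>\<^bsub>G\<^esub>)"

text \<open>A subgroup \<open>N\<close> of \<open>G\<close>, regarded as a group, is \<open>G\<lparr>carrier := N\<rparr>\<close>.\<close>

definition ea_morphic :: "nat \<Rightarrow> ('a, 'b) monoid_scheme \<Rightarrow> bool" where
  "ea_morphic p G \<longleftrightarrow>
     finite_p_group p G \<and>
     (\<forall>N. N \<lhd> G \<and>
          (elementary_abelian p (G\<lparr>carrier := N\<rparr>) \<or> elementary_abelian p (G Mod N)) \<longrightarrow>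
        epi G (G\<lparr>carrier := N\<rparr>) \<noteq> {} \<and>
        (\<forall>\<phi> \<in> epi G (G\<lparr>carrier := N\<rparr>).
           G Mod N \<cong> G\<lparr>carrier := kernel G (G\<lparr>carrier := N\<rparr>) \<phi>\<rparr>))"

definition two_generated :: "('a, 'b) monoid_scheme \<Rightarrow> bool" where
  "two_generated G \<longleftrightarrow> (\<exists>a \<in> carrier G. \<exists>b \<in> carrier G. generate G {a, b} = carrier G)"

end

theory Submission
  imports Defs
begin

text \<open>The proof compares the order of the derived subgroup \<open>G'\<close> with the orders of \<open>M'\<close> and
\<open>(M \<inter> N)'\<close>, where \<open>M\<close> and \<open>N\<close> run over the normal subgroups of index \<open>p\<close>.

If \<open>M\<close> has index \<open>p\<close>, choose a central subgroup \<open>Z\<close> of order \<open>p\<close> inside \<open>G'\<close>; it exists because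
\<open>G\<close> is a nonabelian \<open>p\<close>-group. Both \<open>G/M\<close> and \<open>Z\<close> are cyclic of order \<open>p\<close>, so \<open>M\<close> is the kernel of
an epimorphism \<open>G \<rightarrow> Z\<close>, and the hypothesis gives \<open>G/Z \<cong> M\<close>. Hence \<open>|G'| = p |M'|\<close>
(\<open>ea_morphic_card_derived_prime_index\<close>). If \<open>K = M \<inter> N\<close> with \<open>M\<close>, \<open>N\<close> of index \<open>p\<close>, then \<open>G/K\<close> is
elementary abelian of order at most \<open>p\<^sup>2\<close>; the hypothesis gives an epimorphism \<open>G \<rightarrow> K\<close> with
kernel isomorphic to \<open>G/K\<close>, so \<open>|G'| \<le> p\<^sup>2 |K'|\<close> (\<open>ea_morphic_card_derived_Int\<close>).

These two facts force \<open>M'\<close> to be the same subgroup for all \<open>M\<close> of index \<open>p\<close>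
(\<open>derived_prime_index_unique\<close>). Suppose \<open>M' \<noteq> N'\<close> and divide out \<open>K'\<close>, which by counting equals
\<open>M' \<inter> N'\<close>. In the quotient the images of \<open>M'\<close> and \<open>N'\<close> are distinct central subgroups of order
\<open>p\<close>, their product is the whole derived subgroup, and the image of \<open>K\<close> is abelian. Take
\<open>u \<in> M - K\<close> and \<open>v \<in> N - K\<close>. The commutator maps of \<open>u\<close>, of \<open>v\<close> and of \<open>u v\<close> on \<open>K\<close> all have image
of order \<open>p\<close>, the first two having images that meet trivially; this is only possible if
\<open>[u,-]\<close> and \<open>[v,-]\<close> have the same kernel on \<open>K\<close>, which is therefore central once \<open>u\<close> and \<open>v\<close> have
been adjusted by elements of \<open>K\<close> so as to commute. Then the centralizer of \<open>u\<close> is abelian and has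
index \<open>p\<close> (\<open>abelian_subgroup_of_prime_index\<close>), and its preimage in \<open>G\<close> has a derived subgroup
that is too small.

Finally let \<open>L\<close> be the common value of the \<open>M'\<close>. As \<open>L\<close> is smaller than \<open>G'\<close>, some commutator
\<open>[x,y]\<close> lies outside \<open>L\<close>. If \<open>x\<close> and \<open>y\<close> did not generate \<open>G\<close>, they would lie in a normal subgroup
\<open>M\<close> of index \<open>p\<close>, whence \<open>[x,y] \<in> M' = L\<close>.\<close>

section \<open>Commutators\<close>

definition commutator :: "('a, 'b) monoid_scheme \<Rightarrow> 'a \<Rightarrow> 'a \<Rightarrow> 'a" where
  "commutator G x y = x \<otimes>\<^bsub>G\<^esub> y \<otimes>\<^bsub>G\<^esub> inv\<^bsub>G\<^esub> x \<otimes>\<^bsub>G\<^esub> inv\<^bsub>G\<^esub> y"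

context group
begin

lemma mult_inv_cancel [simp]:
  assumes "x \<in> carrier G" "y \<in> carrier G"
  shows "x \<otimes> (inv x \<otimes> y) = y" "inv x \<otimes> (x \<otimes> y) = y"
  using assms by (simp_all flip: m_assoc)

lemma commutator_closed [simp]:
  "x \<in> carrier G \<Longrightarrow> y \<in> carrier G \<Longrightarrow> commutator G x y \<in> carrier G"
  by (simp add: commutator_def)

lemma commutator_mult_swap:
  assumes "x \<in> carrier G" "y \<in> carrier G"
  shows "commutator G x y \<otimes> (y \<otimes> x) = x \<otimes> y"
  using assms by (simp add: commutator_def m_assoc)

lemma commutator_eq_one_iff:
  assumes "x \<in> carrier G" "y \<in> carrier G"
  shows "commutator G x y = \<one> \<longleftrightarrow> x \<otimes> y = y \<otimes> x"
  using assms commutator_mult_swap[OF assms]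
  by (metis commutator_closed l_cancel_one m_closed r_cancel_one)

lemma inv_commutator:
  assumes "x \<in> carrier G" "y \<in> carrier G"
  shows "inv (commutator G x y) = commutator G y x"
  using assms by (simp add: commutator_def inv_mult_group m_assoc)

lemma commutator_in_derived:
  assumes "x \<in> H" "y \<in> H"
  shows "commutator G x y \<in> derived G H"
  using assms unfolding derived_def commutator_def by (blast intro: generate.incl)

lemma derived_subset_if_commutators:
  assumes "subgroup F G" "\<And>x y. x \<in> H \<Longrightarrow> y \<in> H \<Longrightarrow> commutator G x y \<in> F"
  shows "derived G H \<subseteq> F"
  unfolding derived_def
  using assms by (intro generate_subgroup_incl) (auto simp: commutator_def)

text \<open>By Lagrange, a subgroup of prime order has no proper nontrivial subgroup, so \<open>A \<inter> B\<close> is all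
of \<open>A\<close>. This serves below whenever a nontrivial element of a group of prime order forces
containment.\<close>

lemma prime_order_subgroup_subset:
  assumes prime: "Factorial_Ring.prime (card A)" and A: "subgroup A G" and B: "subgroup B G"
    and a: "a \<in> A" "a \<in> B" "a \<noteq> \<one>"
  shows "A \<subseteq> B"
proof -
  have fin: "finite A"
    using prime card.infinite not_prime_0 by metis
  have sub: "subgroup (A \<inter> B) G"
    using A B by (rule subgroups_Inter_pair)
  have "card (A \<inter> B) dvd card A"
    using group.lagrange[OF subgroup_imp_group[OF A], of "A \<inter> B"] subgroup_incl[OF sub A]
    by (simp add: order_def) (metis dvd_triv_right)
  moreover have "card (A \<inter> B) \<noteq> 1"
    using a subgroup.one_closed[OF sub] by (metis IntI card_1_singletonE singletonD)
  ultimately have "card (A \<inter> B) = card A"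
    using prime by (metis prime_nat_iff)
  then show ?thesis
    using fin by (metis card_subset_eq inf_le1 inf_le2)
qed

lemma prime_order_subgroups_eq:
  assumes "Factorial_Ring.prime (card A)" "card B = card A" "subgroup A G" "subgroup B G"
    and "a \<in> A" "a \<in> B" "a \<noteq> \<one>"
  shows "A = B"
  using prime_order_subgroup_subset[of A B a] prime_order_subgroup_subset[of B A a] assms by auto

end

section \<open>Homomorphisms, quotients and finite p-groups\<close>

text \<open>The powers of a nontrivial element of \<open>C\<close> give an epimorphism from the integers whose kernel does not
depend on \<open>C\<close>; comparing two groups of order \<open>p\<close> with this quotient avoids choosing an
explicit bijection between them.\<close>

lemma prime_order_iso_integers_mod:
  assumes p: "Factorial_Ring.prime p" and C: "group C" "order C = p"
  shows "integer_group Mod {k. int p dvd k} \<cong> C"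
proof -
  interpret C: group C by fact
  have "carrier C \<noteq> {\<one>\<^bsub>C\<^esub>}"
    using p C(2) by (auto simp: order_def)
  then obtain c where c: "c \<in> carrier C" "c \<noteq> \<one>\<^bsub>C\<^esub>"
    using C.one_closed by blast
  then have ord: "C.ord c = p"
    using C.ord_dvd_group_order[OF c(1)] C(2) p C.ord_eq_1[OF c(1)] by (metis prime_nat_iff)
  interpret h: group_hom integer_group C "\<lambda>k::int. c [^]\<^bsub>C\<^esub> k"
    using C.hom_integer_group_pow[OF c(1)]
    by (intro group_hom.intro group_hom_axioms.intro C.is_group) auto
  have "subgroup ((\<lambda>k::int. c [^]\<^bsub>C\<^esub> k) ` carrier integer_group) C"
    by (rule h.img_is_subgroup)
  moreover have "c \<in> (\<lambda>k::int. c [^]\<^bsub>C\<^esub> k) ` carrier integer_group"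
    using c by (auto intro!: image_eqI[of _ _ "1::int"] simp: C.int_pow_1)
  ultimately have "carrier C \<subseteq> (\<lambda>k::int. c [^]\<^bsub>C\<^esub> k) ` carrier integer_group"
    using C.prime_order_subgroup_subset[OF _ C.subgroup_self] c p C(2) by (simp add: order_def)
  then have "(\<lambda>k::int. c [^]\<^bsub>C\<^esub> k) ` carrier integer_group = carrier C"
    using c by auto
  then have "integer_group Mod kernel integer_group C (\<lambda>k. c [^]\<^bsub>C\<^esub> k) \<cong> C"
    by (rule h.FactGroup_iso)
  moreover have "kernel integer_group C (\<lambda>k. c [^]\<^bsub>C\<^esub> k) = {k. int p dvd k}"
    using c ord by (auto simp: kernel_def C.int_pow_eq_id)
  ultimately show ?thesis by simp
qed

lemma prime_order_isomorphic:
  assumes p: "Factorial_Ring.prime p"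
    and A: "group A" "order A = p" and B: "group B" "order B = p"
  shows "A \<cong> B"
proof -
  have "subgroup {k. int p dvd k} integer_group"
    by (rule group.subgroupI) auto
  then have "{k. int p dvd k} \<lhd> integer_group"
    using comm_group.normal_iff_subgroup[OF abelian_integer_group] by metis
  then have "group (integer_group Mod {k. int p dvd k})"
    by (rule normal.factorgroup_is_group)
  then have "A \<cong> integer_group Mod {k. int p dvd k}"
    by (rule group.iso_sym) (rule prime_order_iso_integers_mod[OF p A])
  then show ?thesis
    by (rule iso_trans) (rule prime_order_iso_integers_mod[OF p B])
qed

context normal
begin

lemma projection_hom: "group_hom G (G Mod H) ((#>) H)"
  using r_coset_hom_Mod factorgroup_is_group
  by (intro group_hom.intro group_hom_axioms.intro) auto

lemma projection_image: "(#>) H ` carrier G = carrier (G Mod H)"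
  by (auto simp: FactGroup_def RCOSETS_def)

lemma projection_eq_one_iff: "x \<in> carrier G \<Longrightarrow> H #> x = H \<longleftrightarrow> x \<in> H"
  using coset_join1 coset_join2 subgroup_axioms subset by blast

lemma kernel_projection: "kernel G (G Mod H) ((#>) H) = H"
  using projection_eq_one_iff subset by (auto simp: kernel_def)

end

lemma (in group_hom) hom_commutator:
  "x \<in> carrier G \<Longrightarrow> y \<in> carrier G \<Longrightarrow> h (commutator G x y) = commutator H (h x) (h y)"
  by (simp add: commutator_def)

text \<open>Lagrange together with the first isomorphism theorem for the restriction of \<open>h\<close> to \<open>S\<close>.\<close>

lemma (in group_hom) card_image_mult_kernel:
  assumes S: "subgroup S G"
  shows "card (h ` S) * card (kernel G H h \<inter> S) = card S"
proof -
  have hS: "group_hom (G\<lparr>carrier := S\<rparr>) (H\<lparr>carrier := h ` S\<rparr>) h"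
    using G.subgroup_imp_group[OF S] H.subgroup_imp_group[OF subgroup_img_is_subgroup[OF S]]
      subgroup.mem_carrier[OF S]
    by (intro group_hom.intro group_hom_axioms.intro) (auto simp: hom_def)
  have ker: "kernel (G\<lparr>carrier := S\<rparr>) (H\<lparr>carrier := h ` S\<rparr>) h = kernel G H h \<inter> S"
    using subgroup.mem_carrier[OF S] by (auto simp: kernel_def)
  have "G\<lparr>carrier := S\<rparr> Mod (kernel G H h \<inter> S) \<cong> H\<lparr>carrier := h ` S\<rparr>"
    using group_hom.FactGroup_iso[OF hS] ker by simp
  then have "card (rcosets\<^bsub>G\<lparr>carrier := S\<rparr>\<^esub> (kernel G H h \<inter> S)) = card (h ` S)"
    using iso_same_order unfolding is_iso_def by (fastforce simp: order_def FactGroup_def)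
  then show ?thesis
    using group.lagrange[OF G.subgroup_imp_group[OF S], of "kernel G H h \<inter> S"]
      group_hom.subgroup_kernel[OF hS] ker by (simp add: order_def)
qed

lemma card_derived_iso:
  assumes "group G" "group H" "G \<cong> H"
  shows "card (derived G (carrier G)) = card (derived H (carrier H))"
proof -
  obtain h where h: "h \<in> iso G H"
    using assms(3) by (auto simp: is_iso_def)
  then have "group_hom G H h" "h ` carrier G = carrier H" "inj_on h (carrier G)"
    using assms(1,2) by (auto simp: group_hom_def group_hom_axioms_def iso_def bij_betw_def)
  then show ?thesis
    using group_hom.derived_img[of G H h "carrier G"] group.derived_in_carrier[OF assms(1), of "carrier G"]
    by (metis card_image inj_on_subset subset_refl)
qed

lemma (in group) subgroup_centralizer:
  assumes "g \<in> carrier G"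
  shows "subgroup {x \<in> carrier G. x \<otimes> g = g \<otimes> x} G"
proof (rule subgroupI)
  fix x assume "x \<in> {x \<in> carrier G. x \<otimes> g = g \<otimes> x}"
  then have x: "x \<in> carrier G" "x \<otimes> g = g \<otimes> x" by auto
  then have "inv x \<otimes> (x \<otimes> g) \<otimes> inv x = inv x \<otimes> (g \<otimes> x) \<otimes> inv x" by simp
  then show "inv x \<in> {x \<in> carrier G. x \<otimes> g = g \<otimes> x}"
    using x(1) assms by (simp add: m_assoc)
next
  fix x y assume "x \<in> {x \<in> carrier G. x \<otimes> g = g \<otimes> x}" "y \<in> {x \<in> carrier G. x \<otimes> g = g \<otimes> x}"
  then show "x \<otimes> y \<in> {x \<in> carrier G. x \<otimes> g = g \<otimes> x}"
    using assms by (auto simp: m_assoc) (simp flip: m_assoc)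
qed (use assms in auto)

lemma (in group) subgroup_vimage:
  assumes "group_hom G Q h" "subgroup S Q"
  shows "subgroup {x \<in> carrier G. h x \<in> S} G"
proof -
  interpret h: group_hom G Q h by fact
  interpret S: subgroup S Q by fact
  show ?thesis by (rule subgroupI) auto
qed

lemma prime_dvd_divisor_of_prime_power:
  fixes p d :: nat
  assumes "Factorial_Ring.prime p" "d dvd p ^ n" "d \<noteq> 1"
  shows "p dvd d"
  using assms by (metis divides_primepow_nat dvd_triv_left not0_implies_Suc power_0 power_Suc)

locale finite_prime_power_group = group +
  fixes p :: nat
  assumes prime_p: "Factorial_Ring.prime p"
    and prime_power_order: "\<exists>n::nat. order G = p ^ n"
begin

lemma finite_carrier: "finite (carrier G)"
  using prime_power_order prime_gt_0_nat[OF prime_p] order_gt_0_iff_finite by fastforce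

lemma finite_subgroup: "subgroup H G \<Longrightarrow> finite H"
  using finite_carrier subgroup.subset finite_subset by metis

lemma dvd_card_subgroup:
  assumes H: "subgroup H G" and ne: "H \<noteq> {\<one>}"
  shows "p dvd card H"
proof -
  obtain n where "order G = p ^ n" using prime_power_order by blast
  then have "card H dvd p ^ n"
    using lagrange[OF H] by (metis dvd_triv_right)
  moreover have "card H \<noteq> 1"
    using ne subgroup.one_closed[OF H] by (metis card_1_singletonE singletonD)
  ultimately show ?thesis
    using prime_dvd_divisor_of_prime_power[OF prime_p] by blast
qed

lemma quotient_prime_power:
  assumes "N \<lhd> G"
  shows "finite_prime_power_group (G Mod N) p"
proof -
  obtain n where "order G = p ^ n" using prime_power_order by blast
  then have "card (rcosets N) dvd p ^ n"
    using lagrange[OF normal_imp_subgroup[OF assms]] by (metis dvd_triv_left)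
  then have "\<exists>m. order (G Mod N) = p ^ m"
    using prime_p divides_primepow_nat by (auto simp: order_def FactGroup_def)
  then show ?thesis
    using prime_p normal.factorgroup_is_group[OF assms]
    by (intro finite_prime_power_group.intro finite_prime_power_group_axioms.intro) auto
qed

text \<open>Conjugation partitions \<open>N - {\<one>}\<close> into orbits. If no nontrivial element of \<open>N\<close> were central, every
orbit would have more than one element, hence a size divisible by \<open>p\<close>; but \<open>p\<close> divides \<open>card N\<close>,
so it cannot divide \<open>card N - 1\<close>.\<close>

lemma normal_meets_center:
  assumes N: "N \<lhd> G" and ne: "N \<noteq> {\<one>}"
  shows "\<exists>z\<in>N. z \<noteq> \<one> \<and> (\<forall>g\<in>carrier G. z \<otimes> g = g \<otimes> z)"
proof (rule ccontr)
  assume no: "\<not> ?thesis"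
  interpret N: normal N G by fact
  define act where "act = (\<lambda>g. \<lambda>h \<in> carrier G. g \<otimes> h \<otimes> inv g)"
  interpret act: group_action G "carrier G" act
    unfolding act_def by (rule action_by_conjugation)
  define C where "C = orbit G act ` (N - {\<one>})"
  have in_orbit: "x \<in> orbit G act x" if "x \<in> carrier G" for x
    using that act.orbit_refl by blast
  have orbit_sub: "orbit G act x \<subseteq> N - {\<one>}" if x: "x \<in> N - {\<one>}" for x
  proof
    fix y assume "y \<in> orbit G act x"
    then obtain g where g: "g \<in> carrier G" "y = g \<otimes> x \<otimes> inv g"
      using x N.mem_carrier by (auto simp: orbit_def act_def)
    have "y \<noteq> \<one>"
    proof
      assume "y = \<one>"
      then have "inv g \<otimes> (g \<otimes> x \<otimes> inv g) \<otimes> g = \<one>"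
        using g by simp
      then show False
        using g x N.mem_carrier by (simp add: m_assoc)
    qed
    then show "y \<in> N - {\<one>}"
      using g x N.inv_op_closed2 by simp
  qed
  have union: "\<Union>C = N - {\<one>}"
    using in_orbit orbit_sub N.mem_carrier by (auto simp: C_def)
  have "p dvd card c" if "c \<in> C" for c
  proof -
    obtain x where x: "x \<in> N" "x \<noteq> \<one>" "c = orbit G act x"
      using \<open>c \<in> C\<close> by (auto simp: C_def)
    have xG: "x \<in> carrier G" using x N.mem_carrier by blast
    obtain g where g: "g \<in> carrier G" "x \<otimes> g \<noteq> g \<otimes> x"
      using no x by blast
    have "g \<otimes> x \<otimes> inv g \<noteq> x"
    proof
      assume "g \<otimes> x \<otimes> inv g = x"
      then have "g \<otimes> x \<otimes> inv g \<otimes> g = x \<otimes> g" by simp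
      then show False using g xG by (simp add: m_assoc)
    qed
    moreover have "g \<otimes> x \<otimes> inv g \<in> c"
      using g xG by (auto simp: x(3) orbit_def act_def intro!: exI[of _ g])
    moreover have "x \<in> c" using in_orbit xG x by simp
    ultimately have "card c \<noteq> 1"
      by (metis card_1_singletonE singletonD)
    moreover obtain n where "order G = p ^ n" using prime_power_order by blast
    then have "card c dvd p ^ n"
      using act.orbit_stabilizer_theorem[OF xG] x(3) by (metis dvd_triv_left)
    ultimately show ?thesis
      using prime_dvd_divisor_of_prime_power[OF prime_p] by blast
  qed
  moreover have "disjoint C"
    using act.disjoint_union N.mem_carrier unfolding C_def disjoint_def orbits_def by blast
  moreover have finN: "finite N"
    using N.subgroup_axioms by (rule finite_subgroup)
  ultimately have "p dvd card (N - {\<one>})"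
    using dvd_partition[of C p] union by (auto simp: disjoint_def)
  moreover have "card (N - {\<one>}) + 1 = card N"
    using finN N.one_closed by (metis Suc_eq_plus1 card.remove)
  moreover have "p dvd card N"
    using dvd_card_subgroup[OF N.subgroup_axioms ne] .
  ultimately have "p dvd 1"
    by (metis dvd_add_right_iff)
  then show False
    using prime_p by simp
qed

lemma prime_order_normal_central:
  assumes N: "N \<lhd> G" "card N = p" and x: "x \<in> N" and g: "g \<in> carrier G"
  shows "x \<otimes> g = g \<otimes> x"
proof -
  have "N \<noteq> {\<one>}" using N(2) prime_p by auto
  then obtain z where z: "z \<in> N" "z \<noteq> \<one>" "\<forall>g\<in>carrier G. z \<otimes> g = g \<otimes> z"
    using normal_meets_center[OF N(1)] by blast
  have "N \<subseteq> {x \<in> carrier G. x \<otimes> g = g \<otimes> x}"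
    using z g N prime_p normal_imp_subgroup[OF N(1)] subgroup.mem_carrier
    by (intro prime_order_subgroup_subset[OF _ _ subgroup_centralizer, of _ _ z]) auto
  then show ?thesis using x by blast
qed

lemma exists_power_of_order_p:
  assumes x: "x \<in> carrier G" "x \<noteq> \<one>"
  shows "\<exists>k::nat. ord (x [^] k) = p"
proof -
  obtain n where "order G = p ^ n" using prime_power_order by blast
  then obtain m where m: "ord x = p ^ m"
    using ord_dvd_group_order[OF x(1)] prime_p divides_primepow_nat by auto
  then have "m \<noteq> 0"
    using x ord_eq_1 by (metis power_0)
  then obtain l where "m = Suc l" using not0_implies_Suc by blast
  then have "ord (x [^] (p ^ l)) = p"
    using ord_pow[OF x(1), of "p ^ l"] m prime_gt_0_nat[OF prime_p] by simp
  then show ?thesis by blast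
qed

text \<open>Let \<open>N\<close> be a largest normal subgroup of \<open>G\<close> inside \<open>M\<close>, and let \<open>T\<close> be the preimage of the
centre of \<open>G/N\<close>. That centre is nontrivial, so \<open>T\<close> is strictly larger than \<open>N\<close> and cannot lie
in \<open>M\<close>. Every \<open>t \<in> T\<close> normalizes \<open>M\<close>, because \<open>[t,m] \<in> N \<subseteq> M\<close> for \<open>m \<in> M\<close>; since \<open>M\<close> is
maximal, \<open>M\<close> and one element of \<open>T - M\<close> generate \<open>G\<close>.\<close>

lemma maximal_subgroup_normal:
  assumes M: "subgroup M G" "M \<noteq> carrier G"
    and max: "\<And>L. subgroup L G \<Longrightarrow> M \<subseteq> L \<Longrightarrow> L = M \<or> L = carrier G"
  shows "M \<lhd> G"
proof -
  interpret M: subgroup M G by fact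
  have "finite {N. N \<lhd> G \<and> N \<subseteq> M}"
    using finite_subgroup[OF M(1)] by simp
  moreover have "{\<one>} \<in> {N. N \<lhd> G \<and> N \<subseteq> M}"
    using one_is_normal by simp
  ultimately obtain N where N: "N \<lhd> G" "N \<subseteq> M" and Nmax: "\<And>L. L \<lhd> G \<Longrightarrow> L \<subseteq> M \<Longrightarrow> N \<subseteq> L \<Longrightarrow> N = L"
    using finite_has_maximal2[of "{N. N \<lhd> G \<and> N \<subseteq> M}" "{\<one>}"] by auto
  interpret N: normal N G by fact
  interpret Q: finite_prime_power_group "G Mod N" p
    using N(1) by (rule quotient_prime_power)
  interpret \<pi>: group_hom G "G Mod N" "(#>) N"
    by (rule N.projection_hom)
  define T where "T = {t \<in> carrier G. \<forall>g\<in>carrier G. commutator G t g \<in> N}"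
  have T_iff: "t \<in> T \<longleftrightarrow> t \<in> carrier G \<and> (\<forall>c\<in>carrier (G Mod N). (N #> t) \<otimes>\<^bsub>G Mod N\<^esub> c = c \<otimes>\<^bsub>G Mod N\<^esub> (N #> t))" for t
  proof -
    have "commutator G t g \<in> N \<longleftrightarrow>
        (N #> t) \<otimes>\<^bsub>G Mod N\<^esub> (N #> g) = (N #> g) \<otimes>\<^bsub>G Mod N\<^esub> (N #> t)"
      if tg: "t \<in> carrier G" "g \<in> carrier G" for g
      using tg N.projection_eq_one_iff[of "commutator G t g"] \<pi>.hom_commutator[OF tg]
        Q.commutator_eq_one_iff[OF \<pi>.hom_closed[OF tg(1)] \<pi>.hom_closed[OF tg(2)]]
      by (simp del: mult_FactGroup)
    then show ?thesis
      unfolding T_def N.projection_image[symmetric] by blast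
  qed
  have "T \<lhd> G"
  proof (rule normal_invI)
    have "T = (\<Inter>c\<in>carrier (G Mod N). {t \<in> carrier G. N #> t \<in> {x \<in> carrier (G Mod N). x \<otimes>\<^bsub>G Mod N\<^esub> c = c \<otimes>\<^bsub>G Mod N\<^esub> x}})"
      unfolding set_eq_iff INT_iff mem_Collect_eq
      using T_iff N.projection_image Q.one_closed by blast
    then show "subgroup T G"
      using subgroup_vimage[OF N.projection_hom Q.subgroup_centralizer] Q.one_closed
      by (auto intro!: subgroups_Inter simp del: mult_FactGroup one_FactGroup)
    fix x h assume xh: "x \<in> carrier G" "h \<in> T"
    then have "x \<otimes> h \<otimes> inv x = commutator G x h \<otimes> h"
      using xh by (auto simp: T_def commutator_def m_assoc)
    moreover have "commutator G x h \<in> T"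
    proof -
      have "commutator G x h \<in> N"
        using xh inv_commutator[of h x] N.m_inv_closed[of "commutator G h x"] by (auto simp: T_def)
      then have "N #> commutator G x h = \<one>\<^bsub>G Mod N\<^esub>"
        using N.projection_eq_one_iff xh by (auto simp: T_def)
      then show ?thesis
        using xh T_iff by (auto simp: T_def simp del: mult_FactGroup one_FactGroup)
    qed
    ultimately show "x \<otimes> h \<otimes> inv x \<in> T"
      using \<open>subgroup T G\<close> xh subgroup.m_closed by metis
  qed
  have NT: "N \<subseteq> T"
  proof
    fix x assume "x \<in> N"
    then have "N #> x = \<one>\<^bsub>G Mod N\<^esub>"
      using N.projection_eq_one_iff by auto
    then show "x \<in> T"
      using \<open>x \<in> N\<close> T_iff by (auto simp del: mult_FactGroup one_FactGroup)
  qed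
  have "\<not> T \<subseteq> M"
  proof
    assume "T \<subseteq> M"
    then have "N = T" using Nmax \<open>T \<lhd> G\<close> NT by blast
    have "carrier (G Mod N) \<noteq> {\<one>\<^bsub>G Mod N\<^esub>}"
    proof
      assume "carrier (G Mod N) = {\<one>\<^bsub>G Mod N\<^esub>}"
      then have "carrier G \<subseteq> N"
        using N.projection_image N.projection_eq_one_iff by (metis imageI one_FactGroup singletonD subsetI)
      then show False using N(2) M(2) M.subset by blast
    qed
    then obtain c where c: "c \<in> carrier (G Mod N)" "c \<noteq> \<one>\<^bsub>G Mod N\<^esub>"
        "\<forall>g\<in>carrier (G Mod N). c \<otimes>\<^bsub>G Mod N\<^esub> g = g \<otimes>\<^bsub>G Mod N\<^esub> c"
      using Q.normal_meets_center[OF Q.normal_self] by blast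
    then obtain t where t: "t \<in> carrier G" "c = N #> t"
      using N.projection_image by blast
    then have "t \<in> T" using c T_iff by blast
    then show False
      using t c \<open>N = T\<close> N.projection_eq_one_iff by auto
  qed
  then obtain t where t: "t \<in> T" "t \<notin> M" by blast
  have tG: "t \<in> carrier G" using t by (simp add: T_def)
  have "generate G (insert t M) = carrier G"
  proof -
    have "subgroup (generate G (insert t M)) G"
      using tG M.subset by (intro generate_is_subgroup) auto
    moreover have "insert t M \<subseteq> generate G (insert t M)"
      by (blast intro: generate.incl)
    ultimately show ?thesis
      using max t by blast
  qed
  \<comment> \<open>Conjugating \<open>m\<close> by \<open>x\<close> multiplies it by \<open>[x,m]\<close>, which lies in \<open>N\<close>.\<close>
  have conj_T: "x \<otimes> m \<otimes> inv x \<in> M" if "x \<in> T" "m \<in> M" for x m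
  proof -
    have "x \<otimes> m \<otimes> inv x = commutator G x m \<otimes> m"
      using that by (simp add: T_def commutator_def m_assoc)
    moreover have "commutator G x m \<in> M"
      using that N(2) M.mem_carrier by (auto simp: T_def)
    ultimately show ?thesis
      using that by simp
  qed
  have "\<forall>m\<in>M. x \<otimes> m \<otimes> inv x \<in> M" if "x \<in> generate G (insert t M)" for x
    using that
  proof induction
    case one
    then show ?case by simp
  next
    case (incl x)
    then show ?case using conj_T t by auto
  next
    case (inv x)
    moreover have "inv t \<in> T"
      using t \<open>T \<lhd> G\<close> normal_imp_subgroup subgroup.m_inv_closed by metis
    ultimately show ?case using conj_T by (auto simp: m_assoc)
  next
    case (eng x y)
    then have "x \<in> carrier G" "y \<in> carrier G"
      using \<open>generate G (insert t M) = carrier G\<close> by auto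
    moreover have "x \<otimes> (y \<otimes> m \<otimes> inv y) \<otimes> inv x \<in> M" if "m \<in> M" for m
      using that eng by blast
    ultimately show ?case by (simp add: inv_mult_group m_assoc)
  qed
  then show ?thesis
    using \<open>generate G (insert t M) = carrier G\<close> by (intro normal_invI[OF M(1)]) auto
qed

text \<open>Enlarge \<open>H\<close> to a maximal subgroup \<open>M\<close>, which is normal. The preimage of a subgroup of order \<open>p\<close>
of \<open>G/M\<close> properly contains \<open>M\<close>, so it is \<open>G\<close> and \<open>G/M\<close> itself has order \<open>p\<close>.\<close>

lemma proper_subgroup_in_prime_index:
  assumes H: "subgroup H G" "H \<noteq> carrier G"
  shows "\<exists>M. M \<lhd> G \<and> card (rcosets M) = p \<and> H \<subseteq> M"
proof -
  have "{L. subgroup L G \<and> L \<noteq> carrier G} \<subseteq> Pow (carrier G)"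
    using subgroup.subset by blast
  then have fin: "finite {L. subgroup L G \<and> L \<noteq> carrier G}"
    using finite_carrier finite_subset by blast
  obtain M where M: "subgroup M G" "M \<noteq> carrier G" "H \<subseteq> M"
    and max: "\<And>L. subgroup L G \<Longrightarrow> M \<subseteq> L \<Longrightarrow> L = M \<or> L = carrier G"
    using finite_has_maximal2[OF fin, of H] H by (metis (mono_tags, lifting) mem_Collect_eq)
  interpret M: normal M G
    using maximal_subgroup_normal[OF M(1,2) max] .
  interpret Q: finite_prime_power_group "G Mod M" p
    using M.normal_axioms by (rule quotient_prime_power)
  obtain g where g: "g \<in> carrier G" "g \<notin> M"
    using M M.subset by blast
  then have "M #> g \<in> carrier (G Mod M)" "M #> g \<noteq> \<one>\<^bsub>G Mod M\<^esub>"
    using M.projection_image M.projection_eq_one_iff by auto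
  then obtain k :: nat where "Q.ord ((M #> g) [^]\<^bsub>G Mod M\<^esub> k) = p"
    using Q.exists_power_of_order_p by meson
  then obtain c where c: "c \<in> carrier (G Mod M)" "Q.ord c = p"
    using \<open>M #> g \<in> carrier (G Mod M)\<close> Q.nat_pow_closed by blast
  have sub: "subgroup (generate (G Mod M) {c}) (G Mod M)"
    using c by (intro Q.generate_is_subgroup) auto
  have pre: "subgroup {x \<in> carrier G. M #> x \<in> generate (G Mod M) {c}} G"
    using subgroup_vimage[OF M.projection_hom sub] .
  moreover have "M \<subseteq> {x \<in> carrier G. M #> x \<in> generate (G Mod M) {c}}"
    using M.projection_eq_one_iff subgroup.one_closed[OF sub] M.subset by force
  moreover have "{x \<in> carrier G. M #> x \<in> generate (G Mod M) {c}} \<noteq> M"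
  proof
    assume eq: "{x \<in> carrier G. M #> x \<in> generate (G Mod M) {c}} = M"
    obtain x where x: "x \<in> carrier G" "c = M #> x"
      using c M.projection_image by blast
    then have "x \<in> M"
      using eq generate.incl[of c "{c}" "G Mod M"] by auto
    then have "c = \<one>\<^bsub>G Mod M\<^esub>"
      using x M.projection_eq_one_iff by simp
    then show False
      using c prime_p Q.ord_id by (metis not_prime_1)
  qed
  ultimately have "{x \<in> carrier G. M #> x \<in> generate (G Mod M) {c}} = carrier G"
    using max by blast
  then have "(#>) M ` carrier G \<subseteq> generate (G Mod M) {c}"
    by blast
  then have "carrier (G Mod M) = generate (G Mod M) {c}"
    using subgroup.subset[OF sub] unfolding M.projection_image by (rule subset_antisym)
  then have "card (rcosets M) = p"
    using Q.generate_pow_card[OF c(1)] c(2) by (simp add: FactGroup_def)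
  then show ?thesis
    using M(3) M.normal_axioms by blast
qed

end

section \<open>Subgroups of prime index\<close>

text \<open>The group is its own normal subgroup of order \<open>p\<close>, and such subgroups are central.\<close>

lemma prime_order_comm_group:
  assumes "group Q" and prime: "Factorial_Ring.prime (order Q)"
  shows "comm_group Q"
proof -
  interpret Q: group Q by fact
  interpret Q: finite_prime_power_group Q "order Q"
    using prime by unfold_locales (auto intro: exI[of _ "1::nat"])
  show ?thesis
    using Q.prime_order_normal_central[OF Q.normal_self]
    by (intro Q.group_comm_groupI) (auto simp: order_def)
qed

lemma (in normal) proper_if_nontrivial_quotient:
  assumes "order (G Mod H) \<noteq> 1"
  shows "H \<noteq> carrier G"
proof
  assume "H = carrier G"
  then have "(#>) H ` carrier G = {H}"
    using projection_eq_one_iff by auto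
  then show False
    using assms by (simp add: order_def flip: projection_image)
qed

context group
begin

text \<open>The image of \<open>S \<inter> T\<close> under \<open>h\<close> contains the nontrivial element \<open>h x\<close>, so it is all of \<open>Q\<close>; hence
any \<open>y \<in> S\<close> differs from an element of \<open>S \<inter> T\<close> by an element of the kernel.\<close>

lemma generate_supset_if_prime_quotient:
  assumes h: "group_hom G Q h" and prime: "Factorial_Ring.prime (order Q)"
    and S: "subgroup S G" and T: "subgroup T G"
    and x: "x \<in> S" "x \<in> T" "h x \<noteq> \<one>\<^bsub>Q\<^esub>"
    and ker: "S \<inter> kernel G Q h \<subseteq> T"
  shows "S \<subseteq> T"
proof
  interpret h: group_hom G Q h by fact
  interpret S: subgroup S G by fact
  interpret T: subgroup T G by fact
  fix y assume y: "y \<in> S"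
  have "subgroup (S \<inter> T) G"
    using S T by (rule subgroups_Inter_pair)
  then have "subgroup (h ` (S \<inter> T)) Q"
    by (rule h.subgroup_img_is_subgroup)
  then have "carrier Q \<subseteq> h ` (S \<inter> T)"
    using h.H.prime_order_subgroup_subset[OF _ h.H.subgroup_self, of _ "h x"] x prime S.mem_carrier
    by (auto simp: order_def)
  moreover have "h y \<in> carrier Q"
    using y by simp
  ultimately obtain t where t: "t \<in> S" "t \<in> T" "h y = h t"
    by (meson IntE imageE subsetD)
  then have "y \<otimes> inv t \<in> S \<inter> kernel G Q h"
    using y by (auto simp: kernel_def)
  then have "(y \<otimes> inv t) \<otimes> t \<in> T"
    using ker t T.m_closed by blast
  then show "y \<in> T"
    using y t by (simp add: m_assoc)
qed

lemma prime_index_subgroup_maximal: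
  assumes "Factorial_Ring.prime (order (G Mod M))" "M \<lhd> G" "N \<lhd> G" "M \<subseteq> N" "N \<noteq> carrier G"
  shows "M = N"
proof (rule ccontr)
  assume "M \<noteq> N"
  interpret M: normal M G by fact
  obtain x where x: "x \<in> N" "x \<notin> M" using \<open>M \<noteq> N\<close> assms(4) by blast
  have N: "subgroup N G" using assms(3) by (rule normal_imp_subgroup)
  have "carrier G \<subseteq> N"
    using generate_supset_if_prime_quotient[OF M.projection_hom assms(1) subgroup_self N, of x]
      x M.projection_eq_one_iff M.kernel_projection subgroup.mem_carrier[OF N] assms(4) by auto
  then show False
    using assms(5) subgroup.subset[OF N] by blast
qed

text \<open>\<open>G/M1\<close> and \<open>G/M2\<close> are identified with one group \<open>Q\<close> of order \<open>p\<close>, so that \<open>M1\<close> and \<open>M2\<close> become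
kernels of \<open>h1\<close> and \<open>h2\<close> into \<open>Q\<close>. The third subgroup \<open>M3\<close> is the kernel of the product of \<open>h1\<close> and
\<open>h2\<close>; it contains \<open>u v\<close> when \<open>u \<in> M1\<close> and \<open>v \<in> M2\<close> are chosen with \<open>h1 v = inv (h2 u)\<close>.\<close>

lemma two_prime_index_subgroups:
  assumes p: "Factorial_Ring.prime p"
    and M1: "M1 \<lhd> G" "card (rcosets M1) = p" and M2: "M2 \<lhd> G" "card (rcosets M2) = p"
    and ne: "M1 \<noteq> M2"
  obtains u v M3 where
    "u \<in> carrier G" "v \<in> carrier G"
    "M3 \<lhd> G" "card (rcosets M3) = p"
    "generate G (insert u (M1 \<inter> M2)) = M1"
    "generate G (insert v (M1 \<inter> M2)) = M2"
    "generate G (insert (u \<otimes> v) (M1 \<inter> M2)) = M3"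
    "generate G (insert u (insert v (M1 \<inter> M2))) = carrier G"
proof -
  interpret M1: normal M1 G by fact
  interpret M2: normal M2 G by fact
  define Q where "Q = G Mod M1"
  interpret Q: group Q unfolding Q_def by (rule M1.factorgroup_is_group)
  have ordQ: "order Q = p" "order (G Mod M2) = p"
    using M1(2) M2(2) by (simp_all add: Q_def order_def FactGroup_def)
  interpret Q: comm_group Q
    using Q.is_group ordQ p by (intro prime_order_comm_group) simp_all
  obtain f where f: "f \<in> iso (G Mod M2) Q"
    using prime_order_isomorphic[OF p M2.factorgroup_is_group ordQ(2) Q.is_group ordQ(1)]
    by (auto simp: is_iso_def)
  interpret h1: group_hom G Q "(#>) M1"
    unfolding Q_def by (rule M1.projection_hom)
  define h2 where "h2 = (\<lambda>x. f (M2 #> x))"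
  interpret f: group_hom "G Mod M2" Q f
    using f by (intro group_hom.intro group_hom_axioms.intro M2.factorgroup_is_group Q.is_group)
      (auto simp: iso_def)
  interpret h2: group_hom G Q h2
    using Group.hom_compose[OF group_hom.homh[OF M2.projection_hom] f.homh]
    by (intro group_hom.intro group_hom_axioms.intro is_group Q.is_group) (auto simp: h2_def comp_def)
  have ker1: "kernel G Q ((#>) M1) = M1"
    unfolding Q_def by (rule M1.kernel_projection)
  have ker2: "kernel G Q h2 = M2"
  proof -
    have "f (M2 #> x) = \<one>\<^bsub>Q\<^esub> \<longleftrightarrow> M2 #> x = \<one>\<^bsub>G Mod M2\<^esub>" if "x \<in> carrier G" for x
    proof -
      have "f M2 = \<one>\<^bsub>Q\<^esub>"
        using f.hom_one by simp
      moreover have "M2 #> x \<in> carrier (G Mod M2)"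
        using that M2.projection_image by blast
      ultimately show ?thesis
        using f unfolding f.iso_iff by (metis one_FactGroup)
    qed
    then show ?thesis
      using M2.projection_eq_one_iff M2.subset by (auto simp: kernel_def h2_def)
  qed
  have "order (G Mod M1) \<noteq> 1" "order (G Mod M2) \<noteq> 1"
    using ordQ p prime_gt_1_nat[OF p] by (auto simp: Q_def)
  then have sub1: "M1 \<noteq> carrier G" "M2 \<noteq> carrier G"
    using M1.proper_if_nontrivial_quotient M2.proper_if_nontrivial_quotient by auto
  obtain u where u: "u \<in> M1" "u \<notin> M2"
    using prime_index_subgroup_maximal[of M1 M2] ordQ p M1 M2 sub1 ne by (auto simp: Q_def)
  obtain v0 where v0: "v0 \<in> M2" "v0 \<notin> M1"
    using prime_index_subgroup_maximal[of M2 M1] ordQ p M1 M2 sub1 ne by (auto simp: Q_def)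
  have uG: "u \<in> carrier G" using u by simp
  \<comment> \<open>\<open>M2\<close> maps onto \<open>G/M1\<close>, so \<open>v\<close> can be chosen with any prescribed image there.\<close>
  have "carrier Q \<subseteq> (#>) M1 ` M2"
    using v0 ordQ p ker1
    by (intro Q.prime_order_subgroup_subset[of _ _ "M1 #> v0"] Q.subgroup_self
        h1.subgroup_img_is_subgroup M2.subgroup_axioms)
      (auto simp: order_def kernel_def)
  moreover have "inv\<^bsub>Q\<^esub> h2 u \<in> carrier Q"
    using uG by simp
  ultimately obtain v where v: "v \<in> M2" "M1 #> v = inv\<^bsub>Q\<^esub> h2 u"
    by blast
  have vG: "v \<in> carrier G" using v by simp
  have h2u: "h2 u \<noteq> \<one>\<^bsub>Q\<^esub>" and h1u: "M1 #> u = \<one>\<^bsub>Q\<^esub>" and h2v: "h2 v = \<one>\<^bsub>Q\<^esub>"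
    using u v ker1 ker2 uG by (auto simp: kernel_def)
  have h1v: "M1 #> v \<noteq> \<one>\<^bsub>Q\<^esub>"
    using v h2u uG Q.inv_eq_1_iff by simp
  define h where "h = (\<lambda>x. (M1 #> x) \<otimes>\<^bsub>Q\<^esub> h2 x)"
  interpret h: group_hom G Q h
    by (intro group_hom.intro group_hom_axioms.intro is_group Q.is_group)
      (auto simp: h_def hom_def Q.m_ac)
  define M3 where "M3 = kernel G Q h"
  interpret M3: normal M3 G unfolding M3_def by (rule h.normal_kernel)
  have "h u = h2 u"
    using uG h1u by (simp add: h_def)
  moreover have "h u \<in> h ` carrier G"
    using uG by (rule imageI)
  ultimately have "carrier Q \<subseteq> h ` carrier G"
    using uG h2u ordQ p
    by (intro Q.prime_order_subgroup_subset[of _ _ "h u"] Q.subgroup_self h.img_is_subgroup)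
      (simp_all add: order_def)
  then have "h ` carrier G = carrier Q" by auto
  then have "G Mod M3 \<cong> Q"
    unfolding M3_def by (rule h.FactGroup_iso)
  then have card3: "card (rcosets M3) = p"
    using iso_same_order ordQ unfolding is_iso_def by (fastforce simp: order_def FactGroup_def)
  have uv3: "u \<otimes> v \<in> M3"
  proof -
    have "h v = inv\<^bsub>Q\<^esub> h2 u"
      unfolding h_def v(2) h2v using uG by simp
    then have "h (u \<otimes> v) = \<one>\<^bsub>Q\<^esub>"
      unfolding h.hom_mult[OF uG vG] \<open>h u = h2 u\<close> using uG by simp
    then show ?thesis
      unfolding M3_def kernel_def using uG vG by blast
  qed
  have mem1: "x \<in> M1 \<longleftrightarrow> M1 #> x = \<one>\<^bsub>Q\<^esub>" and mem2: "x \<in> M2 \<longleftrightarrow> h2 x = \<one>\<^bsub>Q\<^esub>"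
    and mem3: "x \<in> M3 \<longleftrightarrow> (M1 #> x) \<otimes>\<^bsub>Q\<^esub> h2 x = \<one>\<^bsub>Q\<^esub>" if "x \<in> carrier G" for x
    using that ker1 ker2 unfolding M3_def kernel_def h_def by blast+
  have K3: "M1 \<inter> M2 \<subseteq> M3" "M3 \<inter> M1 \<subseteq> M1 \<inter> M2"
  proof -
    show "M1 \<inter> M2 \<subseteq> M3"
    proof
      fix x assume x: "x \<in> M1 \<inter> M2"
      then have xG: "x \<in> carrier G" by simp
      show "x \<in> M3"
        using x unfolding mem3[OF xG] Int_iff mem1[OF xG] mem2[OF xG] by simp
    qed
    show "M3 \<inter> M1 \<subseteq> M1 \<inter> M2"
    proof
      fix x assume x: "x \<in> M3 \<inter> M1"
      then have xG: "x \<in> carrier G" by simp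
      show "x \<in> M1 \<inter> M2"
        using x h2.hom_closed[OF xG] unfolding mem3[OF xG] Int_iff mem1[OF xG] mem2[OF xG]
        by (metis Q.l_one)
    qed
  qed
  let ?K = "M1 \<inter> M2"
  have gen: "subgroup (generate G (insert x ?K)) G" "x \<in> generate G (insert x ?K)"
      "?K \<subseteq> generate G (insert x ?K)" if "x \<in> carrier G" for x
    using that M1.subset by (auto intro!: generate_is_subgroup intro: generate.incl)
  have prime: "Factorial_Ring.prime (order Q)" using ordQ p by simp
  have 1: "generate G (insert u ?K) = M1"
  proof
    show "generate G (insert u ?K) \<subseteq> M1"
      using u by (intro generate_subgroup_incl M1.subgroup_axioms) auto
    show "M1 \<subseteq> generate G (insert u ?K)"
    proof (rule generate_supset_if_prime_quotient[OF h2.group_hom_axioms prime M1.subgroup_axioms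
          gen(1)[OF uG] u(1) gen(2)[OF uG] h2u])
      show "M1 \<inter> kernel G Q h2 \<subseteq> generate G (insert u ?K)"
        using gen(3)[OF uG] unfolding ker2 by blast
    qed
  qed
  have 2: "generate G (insert v ?K) = M2"
  proof
    show "generate G (insert v ?K) \<subseteq> M2"
      using v by (intro generate_subgroup_incl M2.subgroup_axioms) auto
    show "M2 \<subseteq> generate G (insert v ?K)"
    proof (rule generate_supset_if_prime_quotient[OF h1.group_hom_axioms prime M2.subgroup_axioms
          gen(1)[OF vG] v(1) gen(2)[OF vG] h1v])
      show "M2 \<inter> kernel G Q ((#>) M1) \<subseteq> generate G (insert v ?K)"
        using gen(3)[OF vG] unfolding ker1 by blast
    qed
  qed
  have 3: "generate G (insert (u \<otimes> v) ?K) = M3"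
  proof
    have uv: "u \<otimes> v \<in> carrier G" using uG vG by simp
    have ne1: "M1 #> (u \<otimes> v) \<noteq> \<one>\<^bsub>Q\<^esub>"
      unfolding h1.hom_mult[OF uG vG] h1u using h1v h1.hom_closed[OF vG] by simp
    show "generate G (insert (u \<otimes> v) ?K) \<subseteq> M3"
      using uv3 K3 by (intro generate_subgroup_incl M3.subgroup_axioms) auto
    show "M3 \<subseteq> generate G (insert (u \<otimes> v) ?K)"
    proof (rule generate_supset_if_prime_quotient[OF h1.group_hom_axioms prime M3.subgroup_axioms
          gen(1)[OF uv] uv3 gen(2)[OF uv] ne1])
      show "M3 \<inter> kernel G Q ((#>) M1) \<subseteq> generate G (insert (u \<otimes> v) ?K)"
        using gen(3)[OF uv] K3(2) unfolding ker1 by blast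
    qed
  qed
  have 4: "generate G (insert u (insert v ?K)) = carrier G"
  proof
    have sub: "subgroup (generate G (insert u (insert v ?K))) G"
      using uG vG M1.subset by (intro generate_is_subgroup) auto
    then show "generate G (insert u (insert v ?K)) \<subseteq> carrier G"
      by (rule subgroup.subset)
    have "M1 \<subseteq> generate G (insert u (insert v ?K))"
      using mono_generate[of "insert u ?K" "insert u (insert v ?K)"] 1 by auto
    moreover have "v \<in> generate G (insert u (insert v ?K))"
      by (blast intro: generate.incl)
    ultimately show "carrier G \<subseteq> generate G (insert u (insert v ?K))"
      using generate_supset_if_prime_quotient[OF h1.group_hom_axioms prime subgroup_self sub vG _ h1v]
      unfolding ker1 by blast
  qed
  show ?thesis
    using that[OF uG vG M3.normal_axioms card3 1 2 3 4] .
qed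

end

section \<open>Groups of class two\<close>

locale class_two_group = group +
  assumes commutator_central:
    "\<lbrakk>x \<in> carrier G; y \<in> carrier G; g \<in> carrier G\<rbrakk>
      \<Longrightarrow> commutator G x y \<otimes> g = g \<otimes> commutator G x y"
begin

lemma commutator_mult_left:
  assumes "x \<in> carrier G" "y \<in> carrier G" "z \<in> carrier G"
  shows "commutator G (x \<otimes> y) z = commutator G x z \<otimes> commutator G y z"
proof -
  have "commutator G (x \<otimes> y) z = x \<otimes> commutator G y z \<otimes> (z \<otimes> inv x \<otimes> inv z)"
    using assms by (simp add: commutator_def inv_mult_group m_assoc)
  also have "x \<otimes> commutator G y z = commutator G y z \<otimes> x"
    using assms commutator_central[of y z x] by simp
  also have "commutator G y z \<otimes> x \<otimes> (z \<otimes> inv x \<otimes> inv z) = commutator G y z \<otimes> commutator G x z"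
    using assms by (simp add: commutator_def m_assoc)
  also have "\<dots> = commutator G x z \<otimes> commutator G y z"
    by (intro commutator_central commutator_closed assms)
  finally show ?thesis .
qed

lemma commutator_mult_right:
  assumes "x \<in> carrier G" "y \<in> carrier G" "z \<in> carrier G"
  shows "commutator G x (y \<otimes> z) = commutator G x y \<otimes> commutator G x z"
proof -
  have "commutator G x (y \<otimes> z) = inv (commutator G y x \<otimes> commutator G z x)"
    using assms commutator_mult_left[of y z x] inv_commutator[of "y \<otimes> z" x] by simp
  also have "\<dots> = commutator G x z \<otimes> commutator G x y"
    using assms by (simp add: inv_mult_group inv_commutator)
  also have "\<dots> = commutator G x y \<otimes> commutator G x z"
    by (intro commutator_central commutator_closed assms)
  finally show ?thesis .
qed

lemma commutator_hom: "x \<in> carrier G \<Longrightarrow> group_hom G G (commutator G x)"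
  by (unfold_locales) (auto simp: hom_def commutator_mult_right)

lemma commutator_inv_right:
  "x \<in> carrier G \<Longrightarrow> y \<in> carrier G \<Longrightarrow> commutator G x (inv y) = inv (commutator G x y)"
  using group_hom.hom_inv[OF commutator_hom] by simp

lemma commutator_inv_left:
  "x \<in> carrier G \<Longrightarrow> y \<in> carrier G \<Longrightarrow> commutator G (inv x) y = inv (commutator G x y)"
  using commutator_inv_right by (metis inv_closed inv_commutator)

lemma subgroup_commutator_preimage:
  assumes "subgroup F G" "x \<in> carrier G"
  shows "subgroup {y \<in> carrier G. commutator G x y \<in> F} G"
proof -
  interpret F: subgroup F G by fact
  interpret c: group_hom G G "commutator G x"
    using assms(2) by (rule commutator_hom)
  show ?thesis
    by (rule subgroupI) (use assms(2) in \<open>auto simp: commutator_mult_right commutator_inv_right\<close>)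
qed

text \<open>For fixed \<open>x\<close> the elements \<open>y\<close> with \<open>[x,y] \<in> F\<close> form a subgroup, so membership extends from the
generators to the group they generate, one argument at a time.\<close>

lemma commutator_mem_generate:
  assumes F: "subgroup F G" and S: "S \<subseteq> carrier G"
    and comm: "\<And>x y. x \<in> S \<Longrightarrow> y \<in> S \<Longrightarrow> commutator G x y \<in> F"
    and xy: "x \<in> generate G S" "y \<in> generate G S"
  shows "commutator G x y \<in> F"
proof -
  have swap: "commutator G b a \<in> F" if "commutator G a b \<in> F" "a \<in> carrier G" "b \<in> carrier G" for a b
    using that F inv_commutator by (metis subgroup.m_inv_closed)
  have gen: "generate G S \<subseteq> carrier G"
    using S by (rule generate_incl)
  have *: "generate G S \<subseteq> {b \<in> carrier G. commutator G a b \<in> F}"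
    if "S \<subseteq> {b \<in> carrier G. commutator G a b \<in> F}" "a \<in> carrier G" for a
    using that subgroup_commutator_preimage[OF F] generate_subgroup_incl by blast
  have "commutator G s x \<in> F" if "s \<in> S" for s
    using *[of s] comm S that xy by blast
  then have "commutator G x s \<in> F" if "s \<in> S" for s
    using that swap S gen xy by blast
  then show ?thesis
    using *[of x] S gen xy by blast
qed

lemma derived_generate_insert:
  assumes K: "subgroup K G" and abelian: "\<And>k l. k \<in> K \<Longrightarrow> l \<in> K \<Longrightarrow> commutator G k l = \<one>"
    and x: "x \<in> carrier G"
  shows "derived G (generate G (insert x K)) = commutator G x ` K"
proof -
  interpret K: subgroup K G by fact
  interpret c: group_hom G G "commutator G x"
    using x by (rule commutator_hom)
  have sub: "subgroup (commutator G x ` K) G"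
    using K by (rule c.subgroup_img_is_subgroup)
  have xx: "commutator G x x = \<one>"
    using x by (simp add: commutator_eq_one_iff)
  have "commutator G a b \<in> commutator G x ` K" if ab: "a \<in> insert x K" "b \<in> insert x K" for a b
  proof (cases "a = x")
    case True
    then show ?thesis
      using ab xx subgroup.one_closed[OF sub] by auto
  next
    case a: False
    show ?thesis
    proof (cases "b = x")
      case True
      then have "commutator G a b = inv (commutator G x a)"
        using a ab x K.mem_carrier by (simp add: inv_commutator)
      then show ?thesis
        using a ab subgroup.m_inv_closed[OF sub] by auto
    next
      case False
      then show ?thesis
        using a ab abelian subgroup.one_closed[OF sub] by auto
    qed
  qed
  then have "commutator G a b \<in> commutator G x ` K"
    if "a \<in> generate G (insert x K)" "b \<in> generate G (insert x K)" for a b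
    using commutator_mem_generate[OF sub _ _ that] x K.subset by simp
  then have "derived G (generate G (insert x K)) \<subseteq> commutator G x ` K"
    by (rule derived_subset_if_commutators[OF sub])
  moreover have "commutator G x k \<in> derived G (generate G (insert x K))" if "k \<in> K" for k
    using that by (intro commutator_in_derived generate.incl) auto
  ultimately show ?thesis by blast
qed

text \<open>The subgroup is the centralizer of \<open>u\<close>, that is, the kernel of \<open>[u,-]\<close>. Its index is \<open>p\<close> because
\<open>[u,-]\<close> takes no values on \<open>G\<close> beyond those on \<open>K\<close>: every element is \<open>k w\<close> with \<open>k \<in> K\<close> and \<open>w\<close> in
the abelian group generated by \<open>u\<close> and \<open>v\<close>. If such an element centralizes \<open>u\<close>, then so does \<open>k\<close>, and
then \<open>k\<close> centralizes \<open>v\<close> too: otherwise \<open>[u v,-]\<close>, whose image has order \<open>p\<close>, would share a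
nontrivial value with \<open>[v,-]\<close> and have the same image, which would put the image of \<open>[u,-]\<close> into that
of \<open>[v,-]\<close>. So \<open>k\<close> is central, and any two elements \<open>k w\<close> of the centralizer commute.\<close>

lemma abelian_subgroup_of_prime_index_commuting:
  assumes p: "Factorial_Ring.prime p"
    and K: "K \<lhd> G" and abelian: "\<And>k l. k \<in> K \<Longrightarrow> l \<in> K \<Longrightarrow> commutator G k l = \<one>"
    and u: "u \<in> carrier G" and v: "v \<in> carrier G"
    and gen: "generate G (insert u (insert v K)) = carrier G"
    and card_u: "card (commutator G u ` K) = p" and card_v: "card (commutator G v ` K) = p"
    and card_uv: "card (commutator G (u \<otimes> v) ` K) = p"
    and disj: "commutator G u ` K \<inter> commutator G v ` K = {\<one>}"
    and uv: "commutator G u v = \<one>"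
  shows "\<exists>A. A \<lhd> G \<and> card (rcosets A) = p \<and> derived G A = {\<one>}"
proof -
  interpret K: normal K G by fact
  interpret U: group_hom G G "commutator G u" using u by (rule commutator_hom)
  interpret V: group_hom G G "commutator G v" using v by (rule commutator_hom)
  interpret UV: group_hom G G "commutator G (u \<otimes> v)" using u v by (intro commutator_hom) simp
  have subU: "subgroup (commutator G u ` K) G" and subV: "subgroup (commutator G v ` K) G"
    and subUV: "subgroup (commutator G (u \<otimes> v) ` K) G"
    using K.subgroup_axioms U.subgroup_img_is_subgroup V.subgroup_img_is_subgroup
      UV.subgroup_img_is_subgroup by blast+
  have mult: "commutator G (u \<otimes> v) k = commutator G u k \<otimes> commutator G v k" if "k \<in> K" for k
    using that u v commutator_mult_left by simp
  have ker_u: "commutator G v k = \<one>" if k: "k \<in> K" "commutator G u k = \<one>" for k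
  proof (rule ccontr)
    assume nz: "commutator G v k \<noteq> \<one>"
    have "commutator G v k \<in> commutator G (u \<otimes> v) ` K"
      using k mult[OF k(1)] v by (intro image_eqI[of _ _ k]) auto
    then have eq: "commutator G v ` K = commutator G (u \<otimes> v) ` K"
      using prime_order_subgroups_eq[OF _ _ subV subUV _ _ nz] p card_v card_uv k by simp
    have "commutator G u l \<in> commutator G v ` K" if "l \<in> K" for l
    proof -
      have "commutator G u l = commutator G (u \<otimes> v) l \<otimes> inv (commutator G v l)"
        using mult[OF that] that u v by (simp add: m_assoc)
      then show ?thesis
        using that eq subgroup.m_closed[OF subV] subgroup.m_inv_closed[OF subV] by (metis imageI)
    qed
    then have "commutator G u ` K \<subseteq> {\<one>}"
      using disj by blast
    then show False
      using card_u p card_mono[of "{\<one>}" "commutator G u ` K"] prime_gt_1_nat[OF p] by simp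
  qed
  \<comment> \<open>The values of \<open>[u,-]\<close> on \<open>G\<close> are reduced to those on \<open>K\<close> through \<open>G = K W\<close>.\<close>
  define W where "W = generate G {u, v}"
  have W: "subgroup W G"
    unfolding W_def using u v by (intro generate_is_subgroup) auto
  have W_comm: "commutator G w w' = \<one>" if "w \<in> W" "w' \<in> W" for w w'
  proof -
    have "commutator G v u = \<one>"
      using u v uv commutator_eq_one_iff by metis
    then have "commutator G w w' \<in> {\<one>}"
      using that u v uv commutator_eq_one_iff[of u u] commutator_eq_one_iff[of v v] unfolding W_def
      by - (rule commutator_mem_generate[OF triv_subgroup, of "{u, v}"], auto)
    then show ?thesis by simp
  qed
  have KW: "carrier G = K <#> W"
  proof -
    have "subgroup (K <#> W) G"
      using K W by (rule mult_norm_subgroup)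
    moreover have "insert u (insert v K) \<subseteq> K <#> W"
    proof -
      have prod: "k \<otimes> w \<in> K <#> W" if "k \<in> K" "w \<in> W" for k w
        using that by (auto simp: set_mult_def)
      have "k \<in> K <#> W" if "k \<in> K" for k
        using prod[OF that subgroup.one_closed[OF W]] that by simp
      moreover have "x \<in> K <#> W" if "x \<in> {u, v}" for x
      proof -
        have "x \<in> W"
          using that by (auto simp: W_def intro: generate.incl)
        then show ?thesis
          using prod[OF K.one_closed, of x] that u v by auto
      qed
      ultimately show ?thesis by blast
    qed
    ultimately have "carrier G \<subseteq> K <#> W"
      using gen generate_subgroup_incl by metis
    then show ?thesis
      using \<open>subgroup (K <#> W) G\<close> subgroup.subset by blast
  qed
  have uw: "commutator G u w = \<one>" if "w \<in> W" for w
    using that W_comm[of u] by (simp add: W_def generate.incl)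
  have decomp: "\<exists>k w. k \<in> K \<and> w \<in> W \<and> x = k \<otimes> w \<and> commutator G u x = commutator G u k"
    if "x \<in> carrier G" for x
  proof -
    obtain k w where kw: "k \<in> K" "w \<in> W" "x = k \<otimes> w"
      using \<open>x \<in> carrier G\<close> unfolding KW by (auto simp: set_mult_def)
    then have "commutator G u x = commutator G u k"
      using u uw subgroup.mem_carrier[OF W] by (simp add: commutator_mult_right)
    then show ?thesis using kw by blast
  qed
  define A where "A = kernel G G (commutator G u)"
  have image: "commutator G u ` carrier G = commutator G u ` K"
    using decomp K.subset by auto
  have "group_hom G (G\<lparr>carrier := commutator G u ` K\<rparr>) (commutator G u)"
    using subgroup_imp_group[OF subU] image commutator_mult_right u
    by (intro group_hom.intro group_hom_axioms.intro) (auto simp: hom_def)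
  then have "G Mod A \<cong> G\<lparr>carrier := commutator G u ` K\<rparr>"
    using group_hom.FactGroup_iso[of G "G\<lparr>carrier := commutator G u ` K\<rparr>" "commutator G u"] image
    by (simp add: A_def kernel_def)
  then have "card (rcosets A) = p"
    using card_u iso_same_order by (fastforce simp: order_def FactGroup_def is_iso_def)
  moreover have "A \<lhd> G"
    unfolding A_def by (rule U.normal_kernel)
  moreover have "commutator G x y = \<one>" if x: "x \<in> A" and y: "y \<in> A" for x y
  proof -
    \<comment> \<open>\<open>k\<close> commutes with each of the generators \<open>u\<close>, \<open>v\<close> and \<open>K\<close> of \<open>G\<close>.\<close>
    have central: "commutator G k g = \<one>" if k: "k \<in> K" "commutator G u k = \<one>" and g: "g \<in> carrier G" for k g
    proof -
      have "generate G (insert u (insert v K)) \<subseteq> {g \<in> carrier G. commutator G k g \<in> {\<one>}}"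
        using k u v ker_u[OF k] abelian K.subset
        by (intro generate_subgroup_incl subgroup_commutator_preimage triv_subgroup)
          (auto simp: commutator_eq_one_iff)
      then show ?thesis
        using gen g by auto
    qed
    obtain k w where kw: "k \<in> K" "w \<in> W" "x = k \<otimes> w" "commutator G u k = \<one>"
      using decomp[of x] x by (auto simp: A_def kernel_def)
    obtain l w' where lw: "l \<in> K" "w' \<in> W" "y = l \<otimes> w'" "commutator G u l = \<one>"
      using decomp[of y] y by (auto simp: A_def kernel_def)
    have c: "w \<in> carrier G" "w' \<in> carrier G" "k \<in> carrier G" "l \<in> carrier G"
      using kw lw W subgroup.mem_carrier K.mem_carrier by metis+
    have "commutator G w l = \<one>"
      using central[OF lw(1,4) c(1)] c commutator_eq_one_iff by metis
    then show ?thesis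
      using kw lw c central W_comm by (simp add: commutator_mult_left commutator_mult_right)
  qed
  then have "derived G A = {\<one>}"
    using derived_subset_if_commutators[OF triv_subgroup, of A]
      subgroup.one_closed[OF derived_is_subgroup[of A]] U.subgroup_kernel subgroup.subset A_def
    by blast
  ultimately show ?thesis by blast
qed

text \<open>Replacing \<open>u\<close> and \<open>v\<close> by \<open>u l\<close> and \<open>v k\<close> with \<open>k, l \<in> K\<close> does not change their commutators with the
abelian group \<open>K\<close>, while it changes \<open>[u,v]\<close> by an arbitrary element of \<open>[u,K] [v,K]\<close>; so \<open>u\<close> and \<open>v\<close>
may be assumed to commute.\<close>

lemma abelian_subgroup_of_prime_index:
  assumes p: "Factorial_Ring.prime p"
    and K: "K \<lhd> G" and abelian: "\<And>k l. k \<in> K \<Longrightarrow> l \<in> K \<Longrightarrow> commutator G k l = \<one>"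
    and u: "u \<in> carrier G" and v: "v \<in> carrier G"
    and gen: "generate G (insert u (insert v K)) = carrier G"
    and card_u: "card (commutator G u ` K) = p" and card_v: "card (commutator G v ` K) = p"
    and card_uv: "card (commutator G (u \<otimes> v) ` K) = p"
    and disj: "commutator G u ` K \<inter> commutator G v ` K = {\<one>}"
    and uv: "commutator G u v \<in> commutator G u ` K <#> commutator G v ` K"
  shows "\<exists>A. A \<lhd> G \<and> card (rcosets A) = p \<and> derived G A = {\<one>}"
proof -
  interpret K: normal K G by fact
  obtain k l where kl: "k \<in> K" "l \<in> K" "commutator G u v = commutator G u k \<otimes> commutator G v l"
    using uv by (auto simp: set_mult_def)
  define u' v' where "u' = u \<otimes> l" and "v' = v \<otimes> inv k"
  have c: "k \<in> carrier G" "l \<in> carrier G" "u' \<in> carrier G" "v' \<in> carrier G"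
    using kl u v by (auto simp: u'_def v'_def)
  have eq: "commutator G u' m = commutator G u m" "commutator G v' m = commutator G v m" if "m \<in> K" for m
    using that kl abelian u v c
    by (simp_all add: u'_def v'_def commutator_mult_left commutator_inv_left)
  have eq': "commutator G (u' \<otimes> v') m = commutator G (u \<otimes> v) m" if "m \<in> K" for m
    using eq that u v c by (simp add: commutator_mult_left)
  have "commutator G l v = inv (commutator G v l)"
    using c v by (simp add: inv_commutator)
  then have uv': "commutator G u' v' = \<one>"
    using kl abelian u v c
    by (simp add: u'_def v'_def commutator_mult_left commutator_mult_right commutator_inv_right
        m_assoc)
  have "insert u (insert v K) \<subseteq> generate G (insert u' (insert v' K))" (is "_ \<subseteq> ?T")
  proof -
    have T: "subgroup ?T G"
      using c K.subset by (intro generate_is_subgroup) auto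
    have sub: "insert u' (insert v' K) \<subseteq> ?T"
      by (blast intro: generate.incl)
    have "u = u' \<otimes> inv l" "v = v' \<otimes> k"
      using u v c by (simp_all add: u'_def v'_def m_assoc)
    then show ?thesis
      using sub kl subgroup.m_closed[OF T] subgroup.m_inv_closed[OF T] by (metis insert_subset subset_iff)
  qed
  then have "generate G (insert u (insert v K)) \<subseteq> ?T"
    using c K.subset by (intro generate_subgroup_incl generate_is_subgroup) auto
  then have gen': "?T = carrier G"
    using gen generate_incl[of "insert u' (insert v' K)"] c K.subset by auto
  have "commutator G u' ` K = commutator G u ` K" "commutator G v' ` K = commutator G v ` K"
    "commutator G (u' \<otimes> v') ` K = commutator G (u \<otimes> v) ` K"
    using eq eq' by auto
  then show ?thesis
    using abelian_subgroup_of_prime_index_commuting[OF p K abelian c(3,4) gen' _ _ _ _ uv']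
      card_u card_v card_uv disj by simp
qed

end

section \<open>Orders of derived subgroups in ea-morphic groups\<close>

lemma (in group_hom) card_derived_epi:
  assumes "h ` carrier G = carrier H"
  shows "card (derived G (carrier G))
    = card (derived H (carrier H)) * card (kernel G H h \<inter> derived G (carrier G))"
  using card_image_mult_kernel[OF G.derived_is_subgroup[OF subset_refl]]
    derived_img[OF subset_refl] assms by simp

context group
begin

lemma comm_groupI_derived:
  assumes "derived G (carrier G) \<subseteq> {\<one>}"
  shows "comm_group G"
proof (rule group_comm_groupI)
  fix x y assume xy: "x \<in> carrier G" "y \<in> carrier G"
  then have "commutator G x y = \<one>"
    using assms commutator_in_derived by blast
  then show "x \<otimes> y = y \<otimes> x"
    using xy commutator_eq_one_iff by simp
qed

lemma derived_consistent_self: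
  assumes "subgroup H G"
  shows "derived (G\<lparr>carrier := H\<rparr>) (carrier (G\<lparr>carrier := H\<rparr>)) = derived G H"
  using derived_consistent[OF subset_refl assms] by simp

lemma elementary_abelian_prime_order:
  assumes "subgroup Z G" "card Z = p" "Factorial_Ring.prime p"
  shows "elementary_abelian p (G\<lparr>carrier := Z\<rparr>)"
  using prime_order_comm_group[OF subgroup_imp_group[OF assms(1)]] assms
    group.pow_order_eq_1[OF subgroup_imp_group[OF assms(1)]]
  unfolding elementary_abelian_def by (simp add: order_def)

lemma prime_index_quotient:
  assumes M: "M \<lhd> G" "card (rcosets M) = p" and p: "Factorial_Ring.prime p"
  shows "derived G (carrier G) \<subseteq> M" and "\<And>x. x \<in> carrier G \<Longrightarrow> x [^] p \<in> M"
proof -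
  interpret M: normal M G by fact
  have ord: "order (G Mod M) = p"
    using M(2) by (simp add: order_def FactGroup_def)
  show "derived G (carrier G) \<subseteq> M"
    using derived_minimal[OF M(1)] prime_order_comm_group[OF M.factorgroup_is_group] ord p by simp
  fix x assume x: "x \<in> carrier G"
  have "M #> (x [^] p) = \<one>\<^bsub>G Mod M\<^esub>"
    using M.FactGroup_pow[OF x, of p] group.pow_order_eq_1[OF M.factorgroup_is_group, of "M #> x"]
      x M.projection_image ord by auto
  then show "x [^] p \<in> M"
    using x M.projection_eq_one_iff by simp
qed

lemma elementary_abelian_quotient:
  assumes K: "K \<lhd> G" and "derived G (carrier G) \<subseteq> K" and "\<And>x. x \<in> carrier G \<Longrightarrow> x [^] p \<in> K"
  shows "elementary_abelian p (G Mod K)"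
proof -
  interpret K: normal K G by fact
  interpret \<pi>: group_hom G "G Mod K" "(#>) K" by (rule K.projection_hom)
  have "derived (G Mod K) (carrier (G Mod K)) = (#>) K ` derived G (carrier G)"
    using \<pi>.derived_img[OF subset_refl] K.projection_image by simp
  also have "\<dots> \<subseteq> {\<one>\<^bsub>G Mod K\<^esub>}"
    using assms(2) K.projection_eq_one_iff K.subset by auto
  finally have "comm_group (G Mod K)"
    by (rule group.comm_groupI_derived[OF K.factorgroup_is_group])
  moreover have "c [^]\<^bsub>G Mod K\<^esub> p = \<one>\<^bsub>G Mod K\<^esub>" if c: "c \<in> carrier (G Mod K)" for c
  proof -
    obtain x where x: "x \<in> carrier G" "c = K #> x"
      using c K.projection_image by blast
    then have "c [^]\<^bsub>G Mod K\<^esub> p = K #> (x [^] p)"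
      using K.FactGroup_pow by simp
    also have "\<dots> = \<one>\<^bsub>G Mod K\<^esub>"
      using assms(3) x K.projection_eq_one_iff by simp
    finally show ?thesis .
  qed
  ultimately show ?thesis
    by (simp add: elementary_abelian_def)
qed

text \<open>\<open>G/(M \<inter> N)\<close> embeds into \<open>G/M \<times> G/N\<close>.\<close>

lemma card_rcosets_Int_le:
  assumes M: "M \<lhd> G" and N: "N \<lhd> G" and fin: "finite (carrier G)"
  shows "card (rcosets (M \<inter> N)) \<le> card (rcosets M) * card (rcosets N)"
proof -
  interpret M: normal M G by fact
  interpret N: normal N G by fact
  define h where "h = (\<lambda>x. (M #> x, N #> x))"
  have "group ((G Mod M) \<times>\<times> (G Mod N))"
    by (intro DirProd_group M.factorgroup_is_group N.factorgroup_is_group)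
  moreover have "h \<in> hom G ((G Mod M) \<times>\<times> (G Mod N))"
    unfolding h_def hom_paired using M.r_coset_hom_Mod N.r_coset_hom_Mod by blast
  ultimately interpret h: group_hom G "(G Mod M) \<times>\<times> (G Mod N)" h
    by (intro group_hom.intro group_hom_axioms.intro is_group)
  have K: "subgroup (M \<inter> N) G"
    by (rule subgroups_Inter_pair[OF M.subgroup_axioms N.subgroup_axioms])
  have "kernel G ((G Mod M) \<times>\<times> (G Mod N)) h = M \<inter> N"
    using M.projection_eq_one_iff N.projection_eq_one_iff M.subset by (auto simp: kernel_def h_def)
  then have "card (h ` carrier G) * card (M \<inter> N) = order G"
    using h.card_image_mult_kernel[OF subgroup_self] subgroup.subset[OF K]
    by (simp add: order_def Int_absorb2)
  moreover have "card (M \<inter> N) > 0"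
    using fin subgroup.subset[OF K] subgroup.one_closed[OF K] by (metis card_gt_0_iff empty_iff finite_subset)
  ultimately have "card (rcosets (M \<inter> N)) = card (h ` carrier G)"
    using lagrange[OF K] by (metis mult_right_cancel neq0_conv)
  also have "\<dots> \<le> card ((rcosets M) \<times> (rcosets N))"
    using fin rcosetsI[OF M.subset] rcosetsI[OF N.subset]
    by (intro card_mono finite_cartesian_product) (auto simp: h_def RCOSETS_def)
  also have "\<dots> = card (rcosets M) * card (rcosets N)"
    by (rule card_cartesian_product)
  finally show ?thesis .
qed

end

context finite_prime_power_group
begin

lemma normal_subgroup_of_order_p:
  assumes N: "N \<lhd> G" "N \<noteq> {\<one>}"
  obtains Z where "Z \<lhd> G" "card Z = p" "Z \<subseteq> N"
proof -
  obtain z where z: "z \<in> N" "z \<noteq> \<one>" "\<forall>g\<in>carrier G. z \<otimes> g = g \<otimes> z"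
    using normal_meets_center[OF N] by blast
  have zG: "z \<in> carrier G"
    using z(1) N(1) normal_imp_subgroup subgroup.mem_carrier by metis
  obtain k :: nat where k: "ord (z [^] k) = p"
    using exists_power_of_order_p[OF zG z(2)] by blast
  define Z where "Z = generate G {z [^] k}"
  have Z: "subgroup Z G"
    unfolding Z_def using zG by (intro generate_is_subgroup) auto
  have "z [^] k \<in> generate G {z}"
    unfolding generate_pow[OF zG] by (auto intro!: exI[of _ "int k"] simp: int_pow_int)
  then have "Z \<subseteq> generate G {z}"
    unfolding Z_def using zG by (intro generate_subgroup_incl generate_is_subgroup) auto
  moreover have "generate G {z} \<subseteq> N"
    using z N normal_imp_subgroup by (intro generate_subgroup_incl) auto
  moreover have "generate G {z} \<subseteq> {x \<in> carrier G. x \<otimes> g = g \<otimes> x}" if "g \<in> carrier G" for g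
    using that z zG by (intro generate_subgroup_incl subgroup_centralizer) auto
  ultimately have ZN: "Z \<subseteq> N" and central: "\<And>x g. x \<in> Z \<Longrightarrow> g \<in> carrier G \<Longrightarrow> x \<otimes> g = g \<otimes> x"
    by blast+
  have "Z \<lhd> G"
  proof (rule normal_invI[OF Z])
    fix g x assume gx: "g \<in> carrier G" "x \<in> Z"
    then have "g \<otimes> x \<otimes> inv g = x \<otimes> g \<otimes> inv g"
      using central by simp
    then show "g \<otimes> x \<otimes> inv g \<in> Z"
      using gx subgroup.mem_carrier[OF Z] by (simp add: m_assoc)
  qed
  moreover have "card Z = p"
    unfolding Z_def using generate_pow_card[of "z [^] k"] k zG by simp
  ultimately show ?thesis
    using that ZN by blast
qed

text \<open>The ea-morphic property is applied to a central subgroup \<open>Z\<close> of order \<open>p\<close> contained in \<open>G'\<close>. As \<open>M\<close> is the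
kernel of an epimorphism onto \<open>Z\<close>, it is isomorphic to \<open>G/Z\<close>, and dividing by \<open>Z \<subseteq> G'\<close> divides the
order of the derived subgroup by exactly \<open>p\<close>.\<close>

lemma ea_morphic_card_derived_prime_index:
  assumes ea: "ea_morphic p G" and nonabelian: "\<not> comm_group G"
    and M: "M \<lhd> G" "card (rcosets M) = p"
  shows "card (derived G M) * p = card (derived G (carrier G))"
proof -
  interpret M: normal M G by fact
  have "derived G (carrier G) \<noteq> {\<one>}"
    using nonabelian comm_groupI_derived by auto
  then obtain Z where Z: "Z \<lhd> G" "card Z = p" "Z \<subseteq> derived G (carrier G)"
    using normal_subgroup_of_order_p[OF derived_self_is_normal] by blast
  interpret Z: normal Z G by fact
  let ?Z = "G\<lparr>carrier := Z\<rparr>"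
  have gZ: "group ?Z" by (rule subgroup_imp_group[OF Z.subgroup_axioms])
  have "G Mod M \<cong> ?Z"
    using prime_order_isomorphic[OF prime_p M.factorgroup_is_group _ gZ] M(2) Z(2)
    by (simp add: order_def FactGroup_def)
  then obtain f where f: "f \<in> iso (G Mod M) ?Z" by (auto simp: is_iso_def)
  interpret f: group_hom "G Mod M" ?Z f
    using f by (intro group_hom.intro group_hom_axioms.intro M.factorgroup_is_group gZ) (auto simp: iso_def)
  have epi: "(\<lambda>x. f (M #> x)) \<in> epi G ?Z"
  proof -
    have "(\<lambda>x. f (M #> x)) \<in> hom G ?Z"
      using Group.hom_compose[OF M.r_coset_hom_Mod f.homh] by (simp add: comp_def)
    moreover have "(\<lambda>x. f (M #> x)) ` carrier G = f ` carrier (G Mod M)"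
      using M.projection_image by (metis image_image)
    ultimately show ?thesis
      using f by (simp add: epi_def iso_def bij_betw_def)
  qed
  have "kernel G ?Z (\<lambda>x. f (M #> x)) = M"
  proof -
    have "f (M #> x) = \<one>\<^bsub>?Z\<^esub> \<longleftrightarrow> x \<in> M" if "x \<in> carrier G" for x
    proof -
      have "f M = \<one>\<^bsub>?Z\<^esub>" using f.hom_one by simp
      moreover have "M #> x \<in> carrier (G Mod M)" using that M.projection_image by blast
      ultimately show ?thesis
        using f M.projection_eq_one_iff[OF that] unfolding f.iso_iff by (metis one_FactGroup)
    qed
    then show ?thesis using M.subset by (auto simp: kernel_def)
  qed
  moreover have "elementary_abelian p ?Z"
    by (rule elementary_abelian_prime_order[OF Z.subgroup_axioms Z(2) prime_p])
  ultimately have "G Mod Z \<cong> G\<lparr>carrier := M\<rparr>"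
    using ea Z(1) epi unfolding ea_morphic_def by metis
  then have "card (derived G M) = card (derived (G Mod Z) (carrier (G Mod Z)))"
    using card_derived_iso[OF Z.factorgroup_is_group subgroup_imp_group[OF M.subgroup_axioms]]
      derived_consistent_self[OF M.subgroup_axioms] by simp
  then show ?thesis
    using group_hom.card_derived_epi[OF Z.projection_hom Z.projection_image] Z
    by (simp add: Z.kernel_projection Int_absorb2)
qed

text \<open>Here the ea-morphic property is applied to \<open>K = M \<inter> N\<close>, which has elementary abelian quotient: \<open>K\<close> is
an image of \<open>G\<close> under a map whose kernel has at most \<open>p\<^sup>2\<close> elements.\<close>

lemma ea_morphic_card_derived_Int:
  assumes ea: "ea_morphic p G"
    and M: "M \<lhd> G" "card (rcosets M) = p" and N: "N \<lhd> G" "card (rcosets N) = p"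
  shows "card (derived G (carrier G)) \<le> p\<^sup>2 * card (derived G (M \<inter> N))"
proof -
  define K where "K = M \<inter> N"
  have K: "K \<lhd> G" unfolding K_def using M(1) N(1) by (rule normal_subgroup_intersect)
  interpret K: normal K G by fact
  let ?K = "G\<lparr>carrier := K\<rparr>"
  have gK: "group ?K" by (rule subgroup_imp_group[OF K.subgroup_axioms])
  have "elementary_abelian p (G Mod K)"
    using prime_index_quotient[OF M prime_p] prime_index_quotient[OF N prime_p]
    by (intro elementary_abelian_quotient K) (auto simp: K_def)
  then have "epi G ?K \<noteq> {} \<and> (\<forall>\<phi>\<in>epi G ?K. G Mod K \<cong> G\<lparr>carrier := kernel G ?K \<phi>\<rparr>)"
    using ea K unfolding ea_morphic_def by blast
  then obtain \<phi> where \<phi>: "\<phi> \<in> epi G ?K" and iso: "G Mod K \<cong> G\<lparr>carrier := kernel G ?K \<phi>\<rparr>"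
    by blast
  interpret \<phi>: group_hom G ?K \<phi>
    using \<phi> by (intro group_hom.intro group_hom_axioms.intro is_group gK) (simp add: epi_def)
  have "card (kernel G ?K \<phi>) = card (rcosets K)"
    using iso iso_same_order unfolding is_iso_def by (fastforce simp: order_def FactGroup_def)
  also have "\<dots> \<le> p * p"
    using card_rcosets_Int_le[OF M(1) N(1) finite_carrier] M(2) N(2) by (simp add: K_def)
  finally have ker: "card (kernel G ?K \<phi> \<inter> derived G (carrier G)) \<le> p * p"
    using card_mono[OF finite_subgroup[OF \<phi>.subgroup_kernel], of "kernel G ?K \<phi> \<inter> derived G (carrier G)"]
    by simp
  have "card (derived G (carrier G)) =
      card (derived G K) * card (kernel G ?K \<phi> \<inter> derived G (carrier G))"
    using \<phi>.card_derived_epi \<phi> derived_consistent_self[OF K.subgroup_axioms]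
    by (simp add: epi_def)
  then show ?thesis
    using ker by (simp add: K_def power2_eq_square mult.commute)
qed

end

section \<open>Two-generation\<close>

context finite_prime_power_group
begin

lemma class_two_if_derived_product:
  assumes A: "A \<lhd> G" "card A = p" and B: "B \<lhd> G" "card B = p"
    and derived: "derived G (carrier G) \<subseteq> A <#> B"
  shows "class_two_group G"
proof unfold_locales
  fix x y g assume xyg: "x \<in> carrier G" "y \<in> carrier G" "g \<in> carrier G"
  then obtain a b where ab: "a \<in> A" "b \<in> B" "commutator G x y = a \<otimes> b"
    using derived commutator_in_derived[of x "carrier G" y] by (auto simp: set_mult_def)
  have c: "a \<in> carrier G" "b \<in> carrier G"
    using ab A(1) B(1) normal_imp_subgroup subgroup.mem_carrier by metis+
  have "a \<otimes> g = g \<otimes> a" "b \<otimes> g = g \<otimes> b"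
    using prime_order_normal_central A B ab xyg by blast+
  then show "commutator G x y \<otimes> g = g \<otimes> commutator G x y"
    using ab c xyg by (metis m_assoc)
qed

lemma set_mult_prime_order_subgroups:
  assumes A: "subgroup A G" "card A = p" and B: "subgroup B G" "card B = p" and ne: "A \<noteq> B"
  shows "A \<inter> B = {\<one>}" and "card (A <#> B) = p * p"
proof -
  show disj: "A \<inter> B = {\<one>}"
    using prime_order_subgroups_eq[of A B] A B ne prime_p subgroup.one_closed by blast
  have "inj_on (\<lambda>(a, b). a \<otimes> b) (A \<times> B)"
  proof (rule inj_onI, clarify)
    fix a b a' b' assume ab: "a \<in> A" "b \<in> B" "a' \<in> A" "b' \<in> B" "a \<otimes> b = a' \<otimes> b'"
    have c: "a \<in> carrier G" "b \<in> carrier G" "a' \<in> carrier G" "b' \<in> carrier G"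
      using ab A(1) B(1) subgroup.mem_carrier by metis+
    have "inv a' \<otimes> a = b' \<otimes> inv b"
      using ab(5) c by (metis inv_closed inv_solve_left inv_solve_right m_assoc m_closed)
    moreover have "inv a' \<otimes> a \<in> A" "b' \<otimes> inv b \<in> B"
      using ab A(1) B(1) by (auto simp: subgroup.m_closed subgroup.m_inv_closed)
    ultimately have "inv a' \<otimes> a = \<one>" "b' \<otimes> inv b = \<one>"
      using disj by auto
    then show "a = a' \<and> b = b'"
      using c by (metis inv_closed inv_equality inv_inv)
  qed
  moreover have "A <#> B = (\<lambda>(a, b). a \<otimes> b) ` (A \<times> B)"
    by (auto simp: set_mult_def)
  ultimately show "card (A <#> B) = p * p"
    using A B by (simp add: card_image card_cartesian_product)
qed

text \<open>The index is a power of \<open>p\<close> other than \<open>1\<close>.\<close>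

lemma card_subgroup_proper:
  assumes A: "subgroup A G" and B: "subgroup B G" and sub: "A \<subset> B"
  shows "p * card A \<le> card B"
proof -
  have "card A dvd card B"
    using group.lagrange[OF subgroup_imp_group[OF B], of A] subgroup_incl[OF A B] sub
    by (simp add: order_def) (metis dvd_triv_right)
  then obtain q where q: "card B = card A * q" by blast
  obtain n where "order G = p ^ n" using prime_power_order by blast
  then have "card B dvd p ^ n"
    using lagrange[OF B] by (metis dvd_triv_right)
  then have "q dvd p ^ n"
    using q by (metis dvd_mult_right)
  moreover have "q \<noteq> 1"
    using q sub finite_subgroup[OF B] by (metis card_subset_eq mult.right_neutral psubset_eq)
  ultimately have "p dvd q"
    using prime_dvd_divisor_of_prime_power[OF prime_p] by blast
  moreover have "q \<noteq> 0"
    using q finite_subgroup[OF B] subgroup.one_closed[OF B]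
    by (metis card_eq_0_iff empty_iff mult_0_right)
  ultimately have "p \<le> q"
    by (simp add: dvd_imp_le)
  then show ?thesis
    using q by (simp add: mult.commute)
qed

text \<open>The quotient by \<open>D = (M1 \<inter> M2)'\<close> satisfies the hypotheses of \<open>abelian_subgroup_of_prime_index\<close>, the
three commutator images being those of \<open>M1'\<close>, \<open>M2'\<close> and \<open>M3'\<close>. The abelian subgroup found there pulls
back to a normal subgroup \<open>M\<close> of index \<open>p\<close> with \<open>M' \<subseteq> D\<close>. This contradicts \<open>|G'| = p |M'|\<close>, as \<open>D\<close> has
index \<open>p\<^sup>2\<close> in \<open>G'\<close>.\<close>

lemma derived_prime_index_unique:
  assumes index: "\<And>M. M \<lhd> G \<Longrightarrow> card (rcosets M) = p \<Longrightarrow>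
      card (derived G M) * p = card (derived G (carrier G))"
    and Int: "\<And>M N. M \<lhd> G \<Longrightarrow> card (rcosets M) = p \<Longrightarrow> N \<lhd> G \<Longrightarrow> card (rcosets N) = p \<Longrightarrow>
      card (derived G (carrier G)) \<le> p\<^sup>2 * card (derived G (M \<inter> N))"
    and M1: "M1 \<lhd> G" "card (rcosets M1) = p" and M2: "M2 \<lhd> G" "card (rcosets M2) = p"
  shows "derived G M1 = derived G M2"
proof (rule ccontr)
  assume ne: "derived G M1 \<noteq> derived G M2"
  obtain u v M3 where u: "u \<in> carrier G" and v: "v \<in> carrier G"
    and M3: "M3 \<lhd> G" "card (rcosets M3) = p"
    and gen_u: "generate G (insert u (M1 \<inter> M2)) = M1"
    and gen_v: "generate G (insert v (M1 \<inter> M2)) = M2"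
    and gen_uv: "generate G (insert (u \<otimes> v) (M1 \<inter> M2)) = M3"
    and gen: "generate G (insert u (insert v (M1 \<inter> M2))) = carrier G"
    using two_prime_index_subgroups[OF prime_p M1 M2] ne by blast
  define K D where "K = M1 \<inter> M2" and "D = derived G K"
  have K: "K \<lhd> G" unfolding K_def using M1(1) M2(1) by (rule normal_subgroup_intersect)
  have KG: "K \<subseteq> carrier G" using K normal_imp_subgroup subgroup.subset by blast
  have sub: "M \<subseteq> carrier G" if "M \<lhd> G" for M
    using that normal_imp_subgroup subgroup.subset by blast
  have der: "subgroup (derived G M) G" if "M \<lhd> G" for M
    using sub[OF that] by (rule derived_is_subgroup)
  have D: "D \<lhd> G" unfolding D_def using K by (rule derived_is_normal)
  have KM3: "K \<subseteq> M3"
    unfolding gen_uv[symmetric] K_def by (blast intro: generate.incl)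
  have D_sub: "D \<subseteq> derived G M1" "D \<subseteq> derived G M2" "D \<subseteq> derived G M3"
    unfolding D_def using KM3 by (auto simp: K_def intro!: mono_derived)
  have card_eq: "card (derived G M1) = card (derived G M2)" "card (derived G M3) = card (derived G M1)"
    using index[OF M1] index[OF M2] index[OF M3] prime_gt_0_nat[OF prime_p]
    by (metis mult_right_cancel neq0_conv)+
  \<comment> \<open>The bound \<open>|G'| \<le> p\<^sup>2 |D|\<close> meets the opposite one, which holds because \<open>M1' \<inter> M2'\<close> contains \<open>D\<close>
    and is a proper subgroup of \<open>M1'\<close>.\<close>
  have cardG: "card (derived G (carrier G)) = p * p * card D" and card1: "card (derived G M1) = p * card D"
  proof -
    let ?I = "derived G M1 \<inter> derived G M2"
    have I: "subgroup ?I G"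
      using der M1(1) M2(1) by (intro subgroups_Inter_pair) auto
    have "?I \<noteq> derived G M1"
    proof
      assume "?I = derived G M1"
      then have "derived G M1 \<subseteq> derived G M2" by blast
      then show False
        using ne card_eq(1) finite_subgroup[OF der[OF M2(1)]] card_subset_eq by metis
    qed
    then have 1: "p * card ?I \<le> card (derived G M1)"
      by (intro card_subgroup_proper I der M1) auto
    have 2: "card D \<le> card ?I"
      using D_sub finite_subgroup[OF I] by (intro card_mono) auto
    have "card (derived G M1) * p \<le> (p * card D) * p"
      using Int[OF M1 M2] index[OF M1] by (simp add: K_def D_def power2_eq_square algebra_simps)
    then have 3: "card (derived G M1) \<le> p * card D"
      using prime_gt_0_nat[OF prime_p] by simp
    then have "p * card ?I \<le> p * card D"
      using 1 by linarith
    then have "card ?I = card D"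
      using 2 prime_gt_0_nat[OF prime_p] by simp
    then show "card (derived G M1) = p * card D"
      using 1 3 by simp
    then show "card (derived G (carrier G)) = p * p * card D"
      using index[OF M1] by (simp add: mult.commute mult.left_commute)
  qed
  interpret D: normal D G by fact
  define Q where "Q = G Mod D"
  interpret Q: finite_prime_power_group Q p
    unfolding Q_def using D by (rule quotient_prime_power)
  define \<pi> where "\<pi> = (#>) D"
  interpret \<pi>: group_hom G Q \<pi>
    unfolding Q_def \<pi>_def by (rule D.projection_hom)
  have onto: "\<pi> ` carrier G = carrier Q"
    unfolding Q_def \<pi>_def by (rule D.projection_image)
  have ker: "kernel G Q \<pi> = D"
    unfolding Q_def \<pi>_def by (rule D.kernel_projection)
  have finD: "card D > 0"
    using finite_subgroup[OF D.subgroup_axioms] D.one_closed by (metis card_gt_0_iff empty_iff)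
  have card_img: "card (\<pi> ` S) * card D = card S" if "subgroup S G" "D \<subseteq> S" for S
  proof -
    have "kernel G Q \<pi> \<inter> S = D"
      using that(2) ker by blast
    then show ?thesis
      using \<pi>.card_image_mult_kernel[OF that(1)] by (simp only:)
  qed
  have cardQ: "card (\<pi> ` derived G M) = p" if "M \<lhd> G" "D \<subseteq> derived G M" "card (derived G M) = p * card D" for M
    using card_img[OF der[OF that(1)] that(2)] finD unfolding that(3) by (metis mult_right_cancel neq0_conv)
  define A1 A2 A3 where "A1 = \<pi> ` derived G M1" and "A2 = \<pi> ` derived G M2" and "A3 = \<pi> ` derived G M3"
  have card_A: "card A1 = p" "card A2 = p" "card A3 = p"
    unfolding A1_def A2_def A3_def
    using cardQ[OF M1(1) D_sub(1)] cardQ[OF M2(1) D_sub(2)] cardQ[OF M3(1) D_sub(3)] card_eq card1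
    by simp_all
  have A_normal: "A1 \<lhd> Q" "A2 \<lhd> Q"
    unfolding A1_def A2_def
    by (rule normal.surj_hom_normal_subgroup[OF derived_is_normal \<pi>.group_hom_axioms onto], rule M1 M2)+
  have "A1 \<noteq> A2"
  proof
    assume eq: "A1 = A2"
    have "derived G M1 \<subseteq> derived G M2"
    proof
      fix x assume x: "x \<in> derived G M1"
      then obtain y where y: "y \<in> derived G M2" "\<pi> x = \<pi> y"
        using eq unfolding A1_def A2_def by (metis imageE imageI)
      have c: "x \<in> carrier G" "y \<in> carrier G"
        using subgroup.mem_carrier[OF der[OF M1(1)] x] subgroup.mem_carrier[OF der[OF M2(1)] y(1)] .
      then have "x \<otimes> inv y \<in> D"
        using y(2) unfolding ker[symmetric] kernel_def by simp
      then have "(x \<otimes> inv y) \<otimes> y \<in> derived G M2"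
        by (rule subgroup.m_closed[OF der[OF M2(1)] subsetD[OF D_sub(2)] y(1)])
      then show "x \<in> derived G M2" using c by (simp add: m_assoc)
    qed
    then show False
      using ne card_eq(1) finite_subgroup[OF der[OF M2(1)]] card_subset_eq by metis
  qed
  note product = Q.set_mult_prime_order_subgroups[OF normal_imp_subgroup[OF A_normal(1)] card_A(1)
      normal_imp_subgroup[OF A_normal(2)] card_A(2) this]
  have derQ: "derived Q (carrier Q) = \<pi> ` derived G (carrier G)"
    using \<pi>.derived_img[OF subset_refl] onto by simp
  \<comment> \<open>Both sides have order \<open>p\<^sup>2\<close>.\<close>
  have "A1 <#>\<^bsub>Q\<^esub> A2 = derived Q (carrier Q)"
  proof (rule card_subset_eq)
    have derQ_sub: "subgroup (derived Q (carrier Q)) Q"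
      by (rule Q.derived_is_subgroup) simp
    then show "finite (derived Q (carrier Q))" by (rule Q.finite_subgroup)
    have "A1 \<subseteq> derived Q (carrier Q)" "A2 \<subseteq> derived Q (carrier Q)"
      unfolding A1_def A2_def derQ
      by (intro image_mono mono_derived sub M1 M2)+
    then show "A1 <#>\<^bsub>Q\<^esub> A2 \<subseteq> derived Q (carrier Q)"
      unfolding set_mult_def using subgroup.m_closed[OF derQ_sub] by blast
    have "card (derived Q (carrier Q)) * card D = (p * p) * card D"
      unfolding derQ cardG[symmetric]
      using D_sub(1) mono_derived[OF sub[OF M1(1)]] by (intro card_img derived_is_subgroup) auto
    then have "card (derived Q (carrier Q)) = p * p"
      using finD by simp
    then show "card (A1 <#>\<^bsub>Q\<^esub> A2) = card (derived Q (carrier Q))"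
      using product(2) by simp
  qed
  then interpret Q2: class_two_group Q
    using Q.class_two_if_derived_product[OF A_normal(1) card_A(1) A_normal(2) card_A(2)] by simp
  have K_normal: "\<pi> ` K \<lhd> Q"
    using normal.surj_hom_normal_subgroup[OF K \<pi>.group_hom_axioms onto] .
  have abelian: "commutator Q k l = \<one>\<^bsub>Q\<^esub>" if "k \<in> \<pi> ` K" "l \<in> \<pi> ` K" for k l
  proof -
    have "derived Q (\<pi> ` K) = \<pi> ` D"
      unfolding D_def using \<pi>.derived_img[OF KG] .
    also have "\<dots> \<subseteq> {\<one>\<^bsub>Q\<^esub>}"
      unfolding ker[symmetric] kernel_def by blast
    finally show ?thesis
      using Q.commutator_in_derived[OF that] by blast
  qed
  \<comment> \<open>Modulo \<open>D\<close> the group \<open>K\<close> is abelian, so the derived subgroup of \<open>\<langle>x, K\<rangle>\<close> consists of the commutators of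
    \<open>x\<close> with elements of \<open>K\<close>.\<close>
  have commutators: "commutator Q (\<pi> x) ` \<pi> ` K = \<pi> ` derived G M"
    if "x \<in> carrier G" "generate G (insert x K) = M" for x M
  proof -
    have "generate Q (insert (\<pi> x) (\<pi> ` K)) = \<pi> ` M"
      using \<pi>.generate_img[of "insert x K"] that KG by simp
    then show ?thesis
      using Q2.derived_generate_insert[OF normal_imp_subgroup[OF K_normal] abelian, of "\<pi> x"] that
        \<pi>.derived_img[of M] generate_incl[of "insert x K"] KG by simp
  qed
  have A: "commutator Q (\<pi> u) ` \<pi> ` K = A1" "commutator Q (\<pi> v) ` \<pi> ` K = A2"
    "commutator Q (\<pi> u \<otimes>\<^bsub>Q\<^esub> \<pi> v) ` \<pi> ` K = A3"
    unfolding A1_def A2_def A3_def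
    using commutators[OF u] commutators[OF v] commutators[of "u \<otimes> v"] u v gen_u gen_v gen_uv
    by (simp_all add: K_def)
  have genQ: "generate Q (insert (\<pi> u) (insert (\<pi> v) (\<pi> ` K))) = carrier Q"
    using \<pi>.generate_img[of "insert u (insert v K)"] gen onto u v KG by (simp add: K_def)
  have uvQ: "commutator Q (\<pi> u) (\<pi> v) \<in> A1 <#>\<^bsub>Q\<^esub> A2"
    using Q.commutator_in_derived[of "\<pi> u" "carrier Q" "\<pi> v"] u v
      \<open>A1 <#>\<^bsub>Q\<^esub> A2 = derived Q (carrier Q)\<close> by simp
  obtain B where B: "B \<lhd> Q" "card (rcosets\<^bsub>Q\<^esub> B) = p" "derived Q B = {\<one>\<^bsub>Q\<^esub>}"
    using Q2.abelian_subgroup_of_prime_index[OF prime_p K_normal abelian \<pi>.hom_closed[OF u]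
        \<pi>.hom_closed[OF v] genQ] A card_A product(1) uvQ by auto
  interpret B: normal B Q by fact
  interpret \<rho>: group_hom Q "Q Mod B" "(#>\<^bsub>Q\<^esub>) B" by (rule B.projection_hom)
  define M where "M = kernel G (Q Mod B) (\<lambda>x. B #>\<^bsub>Q\<^esub> \<pi> x)"
  interpret \<sigma>: group_hom G "Q Mod B" "\<lambda>x. B #>\<^bsub>Q\<^esub> \<pi> x"
    using Group.hom_compose[OF \<pi>.homh \<rho>.homh]
    by (intro group_hom.intro group_hom_axioms.intro is_group B.factorgroup_is_group) (simp add: comp_def)
  have "(\<lambda>x. B #>\<^bsub>Q\<^esub> \<pi> x) ` carrier G = carrier (Q Mod B)"
    using onto B.projection_image by (metis image_image)
  then have "G Mod M \<cong> Q Mod B"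
    unfolding M_def by (rule \<sigma>.FactGroup_iso)
  then have "card (rcosets M) = p"
    using B(2) iso_same_order unfolding is_iso_def by (fastforce simp: order_def FactGroup_def)
  moreover have M: "M \<lhd> G"
    unfolding M_def by (rule \<sigma>.normal_kernel)
  ultimately have cardM: "card (derived G M) * p = p * p * card D"
    using index cardG by simp
  have "\<pi> x \<in> B" if "x \<in> M" for x
    using that B.projection_eq_one_iff[OF \<pi>.hom_closed, of x]
    unfolding M_def kernel_def one_FactGroup mem_Collect_eq by blast
  then have "\<pi> ` M \<subseteq> B"
    by blast
  then have "\<pi> ` derived G M \<subseteq> {\<one>\<^bsub>Q\<^esub>}"
    using \<pi>.derived_img[OF sub[OF M]] Q.mono_derived[of "\<pi> ` M" B] B(3) by simp
  then have "derived G M \<subseteq> D"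
    unfolding ker[symmetric] kernel_def using derived_in_carrier[OF sub[OF M]] by blast
  then have "card (derived G M) \<le> card D"
    using finite_subgroup[OF D.subgroup_axioms] by (rule card_mono[rotated])
  then have "p * p * card D \<le> p * card D"
    using cardM by (metis mult.commute mult_le_mono1)
  then show False
    using finD prime_gt_1_nat[OF prime_p] by simp
qed

text \<open>A pair \<open>x, y\<close> that does not generate \<open>G\<close> lies in some subgroup of index \<open>p\<close>, so \<open>[x,y]\<close> lies in the common
derived subgroup of these. If this held for all pairs, that derived subgroup would be \<open>G'\<close>.\<close>

lemma two_generated_if_derived_unique:
  assumes unique: "\<And>M N. M \<lhd> G \<Longrightarrow> card (rcosets M) = p \<Longrightarrow> N \<lhd> G \<Longrightarrow> card (rcosets N) = p \<Longrightarrow>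
      derived G M = derived G N"
    and proper: "\<And>M. M \<lhd> G \<Longrightarrow> card (rcosets M) = p \<Longrightarrow> derived G M \<noteq> derived G (carrier G)"
  shows "two_generated G"
proof (rule ccontr)
  assume not: "\<not> two_generated G"
  have ex: "\<exists>M. M \<lhd> G \<and> card (rcosets M) = p \<and> {x, y} \<subseteq> M" if xy: "x \<in> carrier G" "y \<in> carrier G" for x y
  proof -
    have "generate G {x, y} \<noteq> carrier G"
      using not xy unfolding two_generated_def by blast
    moreover have "subgroup (generate G {x, y}) G"
      using xy by (intro generate_is_subgroup) auto
    ultimately obtain M where "M \<lhd> G" "card (rcosets M) = p" "generate G {x, y} \<subseteq> M"
      using proper_subgroup_in_prime_index by metis
    moreover have "{x, y} \<subseteq> generate G {x, y}"
      by (blast intro: generate.incl)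
    ultimately show ?thesis by blast
  qed
  obtain M where M: "M \<lhd> G" "card (rcosets M) = p"
    using ex[OF one_closed one_closed] by blast
  have MG: "M \<subseteq> carrier G"
    using M(1) normal_imp_subgroup subgroup.subset by blast
  have "commutator G x y \<in> derived G M" if xy: "x \<in> carrier G" "y \<in> carrier G" for x y
  proof -
    obtain N where N: "N \<lhd> G" "card (rcosets N) = p" "{x, y} \<subseteq> N"
      using ex[OF xy] by blast
    then have "commutator G x y \<in> derived G N"
      by (intro commutator_in_derived) auto
    then show ?thesis
      using unique[OF M N(1,2)] by simp
  qed
  then have "derived G (carrier G) \<subseteq> derived G M"
    by (rule derived_subset_if_commutators[OF derived_is_subgroup[OF MG]])
  then show False
    using proper[OF M] mono_derived[OF MG] by blast
qed

end

theorem theorem1p7: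
  fixes p :: nat and G :: "('a, 'b) monoid_scheme"
  assumes "Factorial_Ring.prime p"
    and "finite_p_group p G"
    and "\<not> comm_group G"
    and "ea_morphic p G"
  shows "two_generated G"
proof -
  interpret finite_prime_power_group G p
    using assms(1,2)
    by (auto simp: finite_p_group_def finite_prime_power_group_def finite_prime_power_group_axioms_def)
  note index = ea_morphic_card_derived_prime_index[OF assms(4,3)]
  show ?thesis
  proof (rule two_generated_if_derived_unique)
    show "derived G M = derived G N"
      if "M \<lhd> G" "card (rcosets\<^bsub>G\<^esub> M) = p" "N \<lhd> G" "card (rcosets\<^bsub>G\<^esub> N) = p" for M N
      using derived_prime_index_unique[OF index ea_morphic_card_derived_Int[OF assms(4)] that] .
    show "derived G M \<noteq> derived G (carrier G)" if M: "M \<lhd> G" "card (rcosets\<^bsub>G\<^esub> M) = p" for M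
    proof
      assume eq: "derived G M = derived G (carrier G)"
      have "card (derived G (carrier G)) > 0"
        using finite_subgroup derived_is_subgroup[OF subset_refl] subgroup.one_closed
        by (metis card_gt_0_iff empty_iff)
      then show False
        using index[OF M] eq prime_gt_1_nat[OF prime_p] by simp
    qed
  qed
qed

end
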